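(* Let $E$ and $F$ be Fréchet spaces and let $\lambda(B)$ be a nuclear Köthe space with Köthe matrix $B=(b_{i,k})_{i,k\in\mathbb{N}}$. Then $(E,\lambda(B),F)\in\mathfrak{TF}$ if and only if there exists a nondecreasing function $S:\mathbb{N}\to\mathbb{N}$ such that for every nondecreasing $\phi:\mathbb{N}\to\mathbb{N}$ the following holds: there exists $k_0\in\mathbb{N}$ such that for every $k\ge k_0$ there exist $q_k\in\mathbb{N}$ and $C_k>0$ with $$\|u'\|^*_{S(k)}\,\|z\|_k\le C_k\max_{1\le q\le q_k}\Bigl\{\|u'\|^*_{\phi(q)}\,b_{i,q}\Bigr\}\max_{1\le q\le q_k}\Bigl\{\frac{\|z\|_q}{b_{i,\phi(q)}}\Bigr\}$$ for every $u'\in E'$, $z\in F$ and $i\in\mathbb{N}$.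
   Context: $\mathbb{N}=\{1,2,3,\dots\}$. Every Fréchet space is equipped with a fixed grading, i.e. an increasing sequence of seminorms $(\|\cdot\|_k)_{k\in\mathbb{N}}$ defining its topology. $E'$ is the topological dual, and $\|u'\|^*_k=\sup_{\|x\|_k\le1}|u'(x)|\in[0,\infty]$ for $u'\in E'$. A Köthe matrix is a matrix $(b_{n,k})_{n,k\in\mathbb{N}}$ of non-negative scalars with $b_{n,k}\le b_{n,k+1}$ for all $n,k$, such that for every $n$ there is $k$ with $b_{n,k}>0$; $\lambda(B)=\{x=(x_j)\in\mathbb{K}^{\mathbb{N}}:\|x\|_k=\sum_j|x_j|b_{j,k}<\infty\ \forall k\in\mathbb{N}\}$, where $\mathbb{K}=\mathbb{R}$ or $\mathbb{C}$, graded by these seminorms. $L(E,F)$ is the space of continuous linear operators $E\to F$. For $T\in L(E,F)$ put $\|T\|_{k,r}=\sup_{\|x\|_r\le1}\|Tx\|_k\in[0,\infty]$ and $\pi_T(k)=\inf\{r\in\mathbb{N}:\|T\|_{k,r}<\infty\}$. $L^G(E,F)$ is the set of $T\in L(E,F)$ of the form $T=RQ$ with $Q\in L(E,G)$, $R\in L(G,F)$. $(E,G,F)\in\mathfrak{TF}$ (tame factorization property) means: there is a nondecreasing $S:\mathbb{N}\to\mathbb{N}$ such that for every $T\in L^G(E,F)$ there is $k_0$ with $\pi_T(k)\le S(k)$ for all $k\ge k_0$. Conventions: quantities are computed in $[0,\infty]$ with $1/0=\infty$ and, inside a single term, $0\cdot\infty=0$ (so $0/0=0$); a product of two maxima is $\infty$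 as soon as one of the maxima is $\infty$. *)

theory Defs
  imports "HOL-Analysis.Analysis" "HOL-Library.Function_Algebras"
begin

text \<open>
  The index set of the positive integers is relabelled order-isomorphically as \<^typ>\<open>nat\<close>
  (index \<open>k\<close> here is \<open>k + 1\<close> in the usual numbering), uniformly for grades, for matrix rows and for
  coordinates.

  The scalar field is an arbitrary type of sort \<open>{real_normed_field, banach}\<close>. By the
  Gelfand-Mazur theorem such a (commutative) field with multiplicative norm is, up to
  isometric isomorphism, the field of the real or of the complex numbers.
\<close>

record ('k, 'v) graded_space =
  gcarrier :: "'v set"
  gscale :: "'k \<Rightarrow> 'v \<Rightarrow> 'v"
  gnorm :: "nat \<Rightarrow> 'v \<Rightarrow> real"

definition graded :: "('k::real_normed_field, 'v::ab_group_add) graded_space \<Rightarrow> bool" where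
  "graded E \<longleftrightarrow>
     vector_space (gscale E) \<and> module.subspace (gscale E) (gcarrier E) \<and>
     (\<forall>k. \<forall>x\<in>gcarrier E. 0 \<le> gnorm E k x) \<and>
     (\<forall>k. \<forall>x\<in>gcarrier E. \<forall>y\<in>gcarrier E. gnorm E k (x + y) \<le> gnorm E k x + gnorm E k y) \<and>
     (\<forall>k c. \<forall>x\<in>gcarrier E. gnorm E k (gscale E c x) = norm c * gnorm E k x) \<and>
     (\<forall>k. \<forall>x\<in>gcarrier E. gnorm E k x \<le> gnorm E (Suc k) x)"

definition gtopology :: "('k, 'v::ab_group_add) graded_space \<Rightarrow> 'v topology" where
  "gtopology E = topology_generated_by
     {{y \<in> gcarrier E. gnorm E k (y - x) < e} | x k e. x \<in> gcarrier E \<and> e > 0}"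

definition gcomplete :: "('k, 'v::ab_group_add) graded_space \<Rightarrow> bool" where
  "gcomplete E \<longleftrightarrow>
     (\<forall>x. range x \<subseteq> gcarrier E \<and>
          (\<forall>k. \<forall>e>0. \<exists>N. \<forall>m\<ge>N. \<forall>n\<ge>N. gnorm E k (x m - x n) < e) \<longrightarrow>
        (\<exists>l. limitin (gtopology E) x l sequentially))"

text \<open>Metrizability and local convexity are automatic for an increasing sequence of seminorms,
  and for a metrizable space sequential completeness is completeness.\<close>

definition frechet_space :: "('k::real_normed_field, 'v::ab_group_add) graded_space \<Rightarrow> bool" where
  "frechet_space E \<longleftrightarrow> graded E \<and> Hausdorff_space (gtopology E) \<and> gcomplete E"

definition linear_map_on ::
    "'v::ab_group_add set \<Rightarrow> ('k \<Rightarrow> 'v \<Rightarrow> 'v) \<Rightarrow> ('k \<Rightarrow> 'w::ab_group_add \<Rightarrow> 'w) \<Rightarrow> ('v \<Rightarrow> 'w) \<Rightarrow> bool" where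
  "linear_map_on V s s' T \<longleftrightarrow>
     (\<forall>x\<in>V. \<forall>y\<in>V. T (x + y) = T x + T y) \<and> (\<forall>c. \<forall>x\<in>V. T (s c x) = s' c (T x))"

text \<open>Operators are total functions of which only the restriction to the carrier matters.\<close>

definition operators ::
    "('k, 'v::ab_group_add) graded_space \<Rightarrow> ('k, 'w::ab_group_add) graded_space \<Rightarrow> ('v \<Rightarrow> 'w) set" where
  "operators E F =
     {T. T ` gcarrier E \<subseteq> gcarrier F \<and>
         linear_map_on (gcarrier E) (gscale E) (gscale F) T \<and>
         continuous_map (gtopology E) (gtopology F) T}"

definition dual :: "('k::real_normed_field, 'v::ab_group_add) graded_space \<Rightarrow> ('v \<Rightarrow> 'k) set" where
  "dual E =
     {u. linear_map_on (gcarrier E) (gscale E) (*) u \<and>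
         continuous_map (gtopology E) euclidean u}"

definition dual_norm ::
    "('k::real_normed_field, 'v) graded_space \<Rightarrow> nat \<Rightarrow> ('v \<Rightarrow> 'k) \<Rightarrow> ennreal" where
  "dual_norm E k u = (SUP x\<in>{x \<in> gcarrier E. gnorm E k x \<le> 1}. ennreal (norm (u x)))"

definition op_norm ::
    "('k, 'v) graded_space \<Rightarrow> ('k, 'w) graded_space \<Rightarrow> nat \<Rightarrow> nat \<Rightarrow> ('v \<Rightarrow> 'w) \<Rightarrow> ennreal" where
  "op_norm E F k r T = (SUP x\<in>{x \<in> gcarrier E. gnorm E r x \<le> 1}. ennreal (gnorm F k (T x)))"

definition char_of_continuity ::
    "('k, 'v) graded_space \<Rightarrow> ('k, 'w) graded_space \<Rightarrow> ('v \<Rightarrow> 'w) \<Rightarrow> nat \<Rightarrow> enat" where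
  "char_of_continuity E F T k = (INF r\<in>{r. op_norm E F k r T < \<infinity>}. enat r)"

definition factoring_operators ::
    "('k, 'v::ab_group_add) graded_space \<Rightarrow> ('k, 'g::ab_group_add) graded_space \<Rightarrow>
     ('k, 'w::ab_group_add) graded_space \<Rightarrow> ('v \<Rightarrow> 'w) set" where
  "factoring_operators E G F =
     {T \<in> operators E F.
        \<exists>Q\<in>operators E G. \<exists>R\<in>operators G F. \<forall>x\<in>gcarrier E. T x = R (Q x)}"

definition tame_factorization ::
    "('k, 'v::ab_group_add) graded_space \<Rightarrow> ('k, 'g::ab_group_add) graded_space \<Rightarrow>
     ('k, 'w::ab_group_add) graded_space \<Rightarrow> bool" where
  "tame_factorization E G F \<longleftrightarrow>
     (\<exists>S :: nat \<Rightarrow> nat. mono S \<and>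
        (\<forall>T\<in>factoring_operators E G F.
           \<exists>k0. \<forall>k\<ge>k0. char_of_continuity E F T k \<le> enat (S k)))"

definition koethe_matrix :: "(nat \<Rightarrow> nat \<Rightarrow> real) \<Rightarrow> bool" where
  "koethe_matrix b \<longleftrightarrow>
     (\<forall>n k. 0 \<le> b n k) \<and> (\<forall>n k. b n k \<le> b n (Suc k)) \<and> (\<forall>n. \<exists>k. 0 < b n k)"

definition koethe_space ::
    "(nat \<Rightarrow> nat \<Rightarrow> real) \<Rightarrow> ('k::real_normed_field, nat \<Rightarrow> 'k) graded_space" where
  "koethe_space b =
     \<lparr>gcarrier = {x. \<forall>k. summable (\<lambda>j. norm (x j) * b j k)},
      gscale = (\<lambda>c x j. c * x j),
      gnorm = (\<lambda>k x. \<Sum>j. norm (x j) * b j k)\<rparr>"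

text \<open>
  Nuclearity in the sense of Grothendieck and Pietsch: every \<open>k\<close> admits \<open>m \<ge> k\<close> such that the
  canonical map between the normed quotients \<open>E/ker \<parallel>\<cdot>\<parallel>\<^sub>m \<longrightarrow> E/ker \<parallel>\<cdot>\<parallel>\<^sub>k\<close>
  is nuclear, i.e. equals \<open>\<Sum>n. f n \<otimes> y n\<close> with \<open>\<Sum>n. \<parallel>f n\<parallel>\<^sup>*\<^sub>m \<parallel>y n\<parallel>\<^sub>k < \<infinity>\<close>.
  The bounded functionals on \<open>E/ker \<parallel>\<cdot>\<parallel>\<^sub>m\<close> are the functionals on \<open>E\<close> with finite \<open>m\<close>-th dual norm,
  and elements of \<open>E/ker \<parallel>\<cdot>\<parallel>\<^sub>k\<close> are given by representatives in \<open>E\<close>. Passing to the completions of the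
  quotients does not change the notion, because their elements are absolutely convergent series
  of elements of the quotients.
\<close>

definition nuclear :: "('k::real_normed_field, 'v::ab_group_add) graded_space \<Rightarrow> bool" where
  "nuclear E \<longleftrightarrow>
     (\<forall>k. \<exists>m\<ge>k. \<exists>(f :: nat \<Rightarrow> 'v \<Rightarrow> 'k) (y :: nat \<Rightarrow> 'v).
        (\<forall>n. f n \<in> dual E \<and> dual_norm E m (f n) < \<infinity> \<and> y n \<in> gcarrier E) \<and>
        (\<Sum>n. dual_norm E m (f n) * ennreal (gnorm E k (y n))) < \<infinity> \<and>
        (\<forall>x\<in>gcarrier E.
           (\<lambda>N. gnorm E k (x - (\<Sum>n<N. gscale E (f n x) (y n)))) \<longlonglongrightarrow> 0))"

text \<open>
  In \<^typ>\<open>ennreal\<close> one has \<open>0 * \<infinity> = 0\<close>, \<open>1 / 0 = \<infinity>\<close> and \<open>0 / 0 = 0\<close>, which is the convention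
  inside a single term. A product of two maxima is instead infinite as soon as one factor is.
\<close>

definition max_prod :: "ennreal \<Rightarrow> ennreal \<Rightarrow> ennreal" where
  "max_prod a b = (if a = \<infinity> \<or> b = \<infinity> then \<infinity> else a * b)"

end

theory Submission imports Defs begin

text \<open>
  If the estimate holds and \<open>T = R Q\<close> factors through the Koethe space, then
  \<open>T x = \<Sum>i. u i x \<cdot> z i\<close> with \<open>u i\<close> the \<open>i\<close>-th coordinate of \<open>Q\<close> and \<open>z i\<close> the image of the \<open>i\<close>-th unit vector
  under \<open>R\<close>. Taking \<open>\<phi>\<close> above the continuity characteristics of \<open>Q\<close> and \<open>R\<close>, shifted so that the
  Grothendieck-Pietsch criterion applies, the first maximum stays bounded in \<open>i\<close> and the second one is
  summable over \<open>i\<close>, which bounds \<open>T\<close> from grade \<open>S k\<close> to grade \<open>k\<close>.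

  Conversely, suppose that the estimate fails for some \<open>\<phi>\<close>. Then there are infinitely many bad grades,
  each violated by rank one operators \<open>x \<mapsto> u x \<cdot> z\<close> through the \<open>i\<close>-th coordinate with arbitrarily large
  constants. Enumerate violations so that every bad grade recurs infinitely often, and let \<open>Q\<close> and \<open>R\<close> be
  the dyadically weighted sums of the operators \<open>u j \<otimes> e (i j)\<close> and \<open>e' (i j) \<otimes> z j\<close> over index sets
  encoded by bit sequences. Tameness of all the products \<open>R Q\<close> and Baire's theorem on the space of pairs
  of bit sequences give a bad grade \<open>k\<close> and a cylinder on which these products are uniformly bounded from
  grade \<open>S k\<close> to grade \<open>k\<close>. Switching the \<open>j\<close>-th bits on and off inside the cylinder bounds the \<open>j\<close>-th
  rank one operators uniformly, contrary to their choice.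
\<close>

section \<open>Graded spaces\<close>

lemma graded_module:
  assumes "graded E"
  shows "module (gscale E)"
  using assms unfolding graded_def vector_space_def module_def by simp

lemma graded_zero_mem: "graded E \<Longrightarrow> 0 \<in> gcarrier E"
  and graded_add_mem: "graded E \<Longrightarrow> x \<in> gcarrier E \<Longrightarrow> y \<in> gcarrier E \<Longrightarrow> x + y \<in> gcarrier E"
  and graded_scale_mem: "graded E \<Longrightarrow> x \<in> gcarrier E \<Longrightarrow> gscale E c x \<in> gcarrier E"
  using module.subspace_def[OF graded_module] unfolding graded_def by blast+

lemma graded_minus_eq: "graded E \<Longrightarrow> gscale E (- 1) x = - x"
  by (simp add: module.scale_minus_left[OF graded_module] module.scale_one[OF graded_module])

lemma graded_uminus_mem: "graded E \<Longrightarrow> x \<in> gcarrier E \<Longrightarrow> - x \<in> gcarrier E"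
  using graded_scale_mem[of E x "- 1"] by (simp add: graded_minus_eq)

lemma graded_diff_mem:
  "graded E \<Longrightarrow> x \<in> gcarrier E \<Longrightarrow> y \<in> gcarrier E \<Longrightarrow> x - y \<in> gcarrier E"
  using graded_add_mem[of E x "- y"] graded_uminus_mem[of E y] by simp

lemma graded_sum_mem:
  assumes "graded E" "\<And>i. i \<in> I \<Longrightarrow> f i \<in> gcarrier E"
  shows "sum f I \<in> gcarrier E"
  using assms(2) by (induction I rule: infinite_finite_induct)
    (auto intro: graded_add_mem[OF assms(1)] graded_zero_mem[OF assms(1)])

lemmas graded_mem = graded_zero_mem graded_add_mem graded_scale_mem graded_uminus_mem
  graded_diff_mem graded_sum_mem

lemma gnorm_nonneg: "graded E \<Longrightarrow> x \<in> gcarrier E \<Longrightarrow> 0 \<le> gnorm E k x"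
  and gnorm_triangle: "graded E \<Longrightarrow> x \<in> gcarrier E \<Longrightarrow> y \<in> gcarrier E \<Longrightarrow>
    gnorm E k (x + y) \<le> gnorm E k x + gnorm E k y"
  and gnorm_scale: "graded E \<Longrightarrow> x \<in> gcarrier E \<Longrightarrow>
    gnorm E k (gscale E c x) = norm c * gnorm E k x"
  unfolding graded_def by blast+

lemma gnorm_mono:
  assumes "graded E" "x \<in> gcarrier E" "k \<le> m"
  shows "gnorm E k x \<le> gnorm E m x"
proof (rule lift_Suc_mono_le[where f = "\<lambda>k. gnorm E k x", OF _ assms(3)])
  show "gnorm E n x \<le> gnorm E (Suc n) x" for n
    using assms(1,2) unfolding graded_def by blast
qed

lemma gnorm_zero: "graded E \<Longrightarrow> gnorm E k 0 = 0"
  using gnorm_scale[of E 0 k 0] module.scale_zero_left[OF graded_module, of E 0]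
  by (simp add: graded_zero_mem)

lemma gnorm_uminus: "graded E \<Longrightarrow> x \<in> gcarrier E \<Longrightarrow> gnorm E k (- x) = gnorm E k x"
  using gnorm_scale[of E x k "- 1"] by (simp add: graded_minus_eq)

lemma gnorm_minus_commute:
  assumes "graded E" "x \<in> gcarrier E" "y \<in> gcarrier E"
  shows "gnorm E k (x - y) = gnorm E k (y - x)"
  using gnorm_uminus[OF assms(1) graded_diff_mem[OF assms]] by simp

lemma gnorm_triangle_diff:
  assumes "graded E" "x \<in> gcarrier E" "y \<in> gcarrier E"
  shows "gnorm E k (x - y) \<le> gnorm E k x + gnorm E k y"
  using gnorm_triangle[OF assms(1,2) graded_uminus_mem[OF assms(1,3)]] gnorm_uminus[OF assms(1,3)]
  by simp

lemma gnorm_dist_triangle: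
  assumes "graded E" "x \<in> gcarrier E" "y \<in> gcarrier E" "z \<in> gcarrier E"
  shows "gnorm E k (x - z) \<le> gnorm E k (x - y) + gnorm E k (y - z)"
  using gnorm_triangle[OF assms(1) graded_diff_mem[OF assms(1,2,3)] graded_diff_mem[OF assms(1,3,4)]]
  by simp

lemma gnorm_le_add_diff:
  assumes "graded E" "x \<in> gcarrier E" "y \<in> gcarrier E"
  shows "gnorm E k x \<le> gnorm E k y + gnorm E k (x - y)"
  using gnorm_triangle[OF assms(1,3) graded_diff_mem[OF assms]] by simp

lemma gnorm_sum_le:
  assumes "graded E" "\<And>i. i \<in> I \<Longrightarrow> f i \<in> gcarrier E"
  shows "gnorm E k (sum f I) \<le> (\<Sum>i\<in>I. gnorm E k (f i))"
  using assms(2)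
proof (induction I rule: infinite_finite_induct)
  case (insert a I)
  then show ?case
    using gnorm_triangle[OF assms(1), of "f a" "sum f I" k] graded_sum_mem[OF assms(1), of I f]
    by fastforce
qed (simp_all add: gnorm_zero[OF assms(1)])

section \<open>Homogeneous functions and suprema over unit balls\<close>

lemma gnorm_le_scale_unit:
  assumes "graded E" "x \<in> gcarrier E" "\<And>c x. x \<in> gcarrier E \<Longrightarrow> p (gscale E c x) = norm c * p x"
    and "\<And>x. x \<in> gcarrier E \<Longrightarrow> gnorm E r x \<le> 1 \<Longrightarrow> p x \<le> c"
  shows "p x \<le> c * gnorm E r x"
proof -
  \<comment> \<open>A seminorm may vanish at \<open>x\<close>, so \<open>x\<close> cannot be divided
    by its own seminorm. It is divided by every larger \<open>e\<close> instead, and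
    \<open>e\<close> then decreases to \<open>gnorm E r x\<close>.\<close>
  have step: "p x \<le> c * e" if e: "e > gnorm E r x" for e
  proof -
    have e0: "e > 0" using gnorm_nonneg[OF assms(1,2)] e by (rule le_less_trans)
    define y where "y = gscale E (of_real (1 / e)) x"
    have "y \<in> gcarrier E" unfolding y_def by (rule graded_scale_mem[OF assms(1,2)])
    moreover have "gnorm E r y \<le> 1"
      using e e0 by (simp add: y_def gnorm_scale[OF assms(1,2)] norm_divide)
    ultimately have "p y \<le> c" by (rule assms(4))
    then show ?thesis using e0 by (simp add: y_def assms(3)[OF assms(2)] norm_divide field_simps)
  qed
  have "((\<lambda>e. c * e) \<longlongrightarrow> c * gnorm E r x) (at_right (gnorm E r x))"
    by (intro tendsto_intros)
  then show ?thesis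
    by (rule tendsto_lowerbound) (auto simp: eventually_at_right_less intro: eventually_mono[OF eventually_at_right_less] step)
qed

text \<open>Lets the extended suprema in \<open>dual_norm\<close> and \<open>op_norm\<close> be
  handled as real inequalities on the whole carrier; \<open>p\<close> stands for the norm of a
  functional value or for a seminorm of an image.\<close>

lemma SUP_unit_ball_le_iff:
  assumes "graded E" "0 \<le> c" "\<And>x. x \<in> gcarrier E \<Longrightarrow> 0 \<le> p x"
    "\<And>c x. x \<in> gcarrier E \<Longrightarrow> p (gscale E c x) = norm c * p x"
  shows "(SUP x\<in>{x \<in> gcarrier E. gnorm E r x \<le> 1}. ennreal (p x)) \<le> ennreal c \<longleftrightarrow>
    (\<forall>x\<in>gcarrier E. p x \<le> c * gnorm E r x)"
proof
  assume "(SUP x\<in>{x \<in> gcarrier E. gnorm E r x \<le> 1}. ennreal (p x)) \<le> ennreal c"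
  then have "p x \<le> c" if "x \<in> gcarrier E" "gnorm E r x \<le> 1" for x
    using that assms(2) by (auto simp: SUP_le_iff)
  then show "\<forall>x\<in>gcarrier E. p x \<le> c * gnorm E r x"
    using gnorm_le_scale_unit[OF assms(1) _ assms(4)] by blast
next
  assume *: "\<forall>x\<in>gcarrier E. p x \<le> c * gnorm E r x"
  have "p x \<le> c" if "x \<in> gcarrier E" "gnorm E r x \<le> 1" for x
    using *[rule_format, OF that(1)] mult_left_mono[OF that(2) assms(2)] by simp
  then show "(SUP x\<in>{x \<in> gcarrier E. gnorm E r x \<le> 1}. ennreal (p x)) \<le> ennreal c"
    by (auto simp: SUP_le_iff intro!: ennreal_leI)
qed

section \<open>The topology of a graded space\<close>

lemma topspace_gtopology:
  assumes "graded E"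
  shows "topspace (gtopology E) = gcarrier E"
proof -
  have "x \<in> {y \<in> gcarrier E. gnorm E 0 (y - x) < 1}" if "x \<in> gcarrier E" for x
    using that by (simp add: gnorm_zero[OF assms])
  then have "x \<in> topspace (gtopology E)" if "x \<in> gcarrier E" for x
    unfolding gtopology_def topology_generated_by_topspace
    using that zero_less_one by blast
  moreover have "topspace (gtopology E) \<subseteq> gcarrier E"
    unfolding gtopology_def topology_generated_by_topspace by blast
  ultimately show ?thesis by blast
qed

lemma openin_gtopology_ball:
  assumes "graded E" "x \<in> gcarrier E" "0 < e"
  shows "openin (gtopology E) {y \<in> gcarrier E. gnorm E k (y - x) < e}"
  unfolding gtopology_def using assms by (intro topology_generated_by_Basis) blast

text \<open>The balls are only declared to be a subbase. As the seminorms increase with the grade,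
  the intersection of two balls contains a ball of the larger grade around each of its points, so
  the balls centred at a point form a neighbourhood base there.\<close>

lemma openin_gtopology_iff:
  assumes "graded E"
  shows "openin (gtopology E) U \<longleftrightarrow> U \<subseteq> gcarrier E \<and>
    (\<forall>x\<in>U. \<exists>k. \<exists>e>0. {y \<in> gcarrier E. gnorm E k (y - x) < e} \<subseteq> U)" (is "?L \<longleftrightarrow> ?R")
proof
  assume ?L
  then have "generate_topology_on
      {{y \<in> gcarrier E. gnorm E k (y - x) < e} | x k e. x \<in> gcarrier E \<and> e > 0} U"
    unfolding gtopology_def by (rule openin_topology_generated_by)
  then have "\<exists>k. \<exists>e>0. {y \<in> gcarrier E. gnorm E k (y - x) < e} \<subseteq> U" if "x \<in> U" for x
    using that
  proof (induction arbitrary: x rule: generate_topology_on.induct)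
    case (Int A B)
    have "x \<in> A" "x \<in> B" using Int.prems by auto
    from Int.IH(1)[OF this(1)] obtain k e
      where A: "e > 0" "{y \<in> gcarrier E. gnorm E k (y - x) < e} \<subseteq> A" by auto
    from Int.IH(2)[OF \<open>x \<in> B\<close>] obtain m d
      where B: "d > 0" "{y \<in> gcarrier E. gnorm E m (y - x) < d} \<subseteq> B" by auto
    have "x \<in> gcarrier E"
      using openin_subset[of "gtopology E"] Int(1,5) topspace_gtopology[OF assms]
      unfolding gtopology_def openin_topology_generated_by_iff by blast
    then have "gnorm E k (y - x) < e \<and> gnorm E m (y - x) < d"
      if "y \<in> gcarrier E" "gnorm E (max k m) (y - x) < min d e" for y
      using that gnorm_mono[OF assms graded_diff_mem[OF assms], of y x k "max k m"]
        gnorm_mono[OF assms graded_diff_mem[OF assms], of y x m "max k m"] by auto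
    then have "{y \<in> gcarrier E. gnorm E (max k m) (y - x) < min d e} \<subseteq> A \<inter> B"
      using A(2) B(2) by blast
    moreover have "min d e > 0" using A(1) B(1) by simp
    ultimately show ?case by blast
  next
    case (UN K)
    then obtain A where A: "A \<in> K" "x \<in> A" by blast
    then obtain k e where "e > 0" "{y \<in> gcarrier E. gnorm E k (y - x) < e} \<subseteq> A"
      using UN.IH by blast
    then show ?case using A(1) by blast
  next
    case (Basis s)
    then obtain a k e where s: "s = {y \<in> gcarrier E. gnorm E k (y - a) < e}" "a \<in> gcarrier E" "e > 0"
      by blast
    have x: "x \<in> gcarrier E" "gnorm E k (x - a) < e" using Basis(2) s by auto
    have "gnorm E k (y - a) < e" if "y \<in> gcarrier E" "gnorm E k (y - x) < e - gnorm E k (x - a)" for y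
      using gnorm_dist_triangle[OF assms that(1) x(1) s(2), of k] that(2) by simp
    then show ?case using x(2) s(1)
      by (intro exI[of _ k] exI[of _ "e - gnorm E k (x - a)"]) auto
  qed simp
  then show ?R using openin_subset[OF \<open>?L\<close>] topspace_gtopology[OF assms] by blast
next
  assume R: ?R
  show ?L
  proof (subst openin_subopen, intro ballI)
    fix x assume "x \<in> U"
    then obtain k e where "e > 0" "{y \<in> gcarrier E. gnorm E k (y - x) < e} \<subseteq> U" using R by blast
    moreover have "x \<in> gcarrier E" using R \<open>x \<in> U\<close> by blast
    ultimately show "\<exists>T. openin (gtopology E) T \<and> x \<in> T \<and> T \<subseteq> U"
      using openin_gtopology_ball[OF assms \<open>x \<in> gcarrier E\<close>]
      by (intro exI[of _ "{y \<in> gcarrier E. gnorm E k (y - x) < e}"]) (simp add: gnorm_zero[OF assms])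
  qed
qed

lemma limitin_gtopology_iff:
  assumes "graded E" "range x \<subseteq> gcarrier E"
  shows "limitin (gtopology E) x l sequentially \<longleftrightarrow>
    l \<in> gcarrier E \<and> (\<forall>k. (\<lambda>n. gnorm E k (x n - l)) \<longlonglongrightarrow> 0)" (is "?L \<longleftrightarrow> ?R")
proof
  assume L: ?L
  then have l: "l \<in> gcarrier E" using limitin_topspace[OF L] topspace_gtopology[OF assms(1)] by simp
  have "(\<lambda>n. gnorm E k (x n - l)) \<longlonglongrightarrow> 0" for k
  proof (rule tendstoI)
    fix e :: real assume "e > 0"
    then have "\<forall>\<^sub>F n in sequentially. x n \<in> {y \<in> gcarrier E. gnorm E k (y - l) < e}"
      using L openin_gtopology_ball[OF assms(1) l \<open>e > 0\<close>, of k] l gnorm_zero[OF assms(1)]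
      unfolding limitin_def by auto
    then show "\<forall>\<^sub>F n in sequentially. dist (gnorm E k (x n - l)) 0 < e"
    proof eventually_elim
      case (elim n)
      then show ?case using gnorm_nonneg[OF assms(1) graded_diff_mem[OF assms(1) _ l], of "x n" k] by simp
    qed
  qed
  with l show ?R by blast
next
  assume R: ?R
  have "\<forall>\<^sub>F n in sequentially. x n \<in> U" if U: "openin (gtopology E) U" "l \<in> U" for U
  proof -
    obtain k e where ke: "e > 0" "{y \<in> gcarrier E. gnorm E k (y - l) < e} \<subseteq> U"
      using U openin_gtopology_iff[OF assms(1)] by blast
    have "\<forall>\<^sub>F n in sequentially. gnorm E k (x n - l) < e"
      using R order_tendstoD(2)[of "\<lambda>n. gnorm E k (x n - l)" 0 sequentially e] ke(1) by blast
    then show ?thesis by (rule eventually_mono) (use ke(2) assms(2) in auto)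
  qed
  then show ?L using R topspace_gtopology[OF assms(1)] unfolding limitin_def by blast
qed

lemma Hausdorff_gtopology_iff:
  assumes "graded E"
  shows "Hausdorff_space (gtopology E) \<longleftrightarrow> (\<forall>x\<in>gcarrier E. (\<forall>k. gnorm E k x = 0) \<longrightarrow> x = 0)"
    (is "?L \<longleftrightarrow> ?R")
proof
  assume L: ?L
  show ?R
  proof (intro ballI impI)
    fix x assume x: "x \<in> gcarrier E" "\<forall>k. gnorm E k x = 0"
    \<comment> \<open>A vector on which all seminorms vanish makes the constant sequence converge
      both to \<open>0\<close> and to the vector itself.\<close>
    have "limitin (gtopology E) (\<lambda>n. x) 0 sequentially"
      "limitin (gtopology E) (\<lambda>n. x) x sequentially"
      using x 
      by (auto simp: topspace_gtopology[OF assms] limitin_gtopology_iff[OF assms] graded_zero_mem[OF assms]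
        gnorm_zero[OF assms] gnorm_uminus[OF assms])
    then show "x = 0" 
      using limitin_Hausdorff_unique[OF _ _ trivial_limit_sequentially L] by blast
  qed
next
  assume R: ?R
  show ?L unfolding Hausdorff_space_def topspace_gtopology[OF assms]
  proof (intro allI impI)
    fix x y assume xy: "x \<in> gcarrier E \<and> y \<in> gcarrier E \<and> x \<noteq> y"
    then have "x - y \<in> gcarrier E" "x - y \<noteq> 0" using graded_diff_mem[OF assms] by auto
    then obtain k where "gnorm E k (x - y) \<noteq> 0" using R by blast
    then have pos: "gnorm E k (x - y) / 2 > 0"
      using gnorm_nonneg[OF assms \<open>x - y \<in> gcarrier E\<close>, of k] by simp
    let ?B = "\<lambda>a. {z \<in> gcarrier E. gnorm E k (z - a) < gnorm E k (x - y) / 2}"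
    have "gnorm E k (x - y) \<le> gnorm E k (z - x) + gnorm E k (z - y)" if "z \<in> gcarrier E" for z
      using gnorm_dist_triangle[OF assms, of x z y k] gnorm_minus_commute[OF assms, of x z k] xy that by simp
    then have "\<not> (z \<in> ?B x \<and> z \<in> ?B y)" for z 
      by (smt (verit) mem_Collect_eq field_sum_of_halves)
    then have "disjnt (?B x) (?B y)" unfolding disjnt_iff by blast
    then show "\<exists>U V. openin (gtopology E) U \<and> openin (gtopology E) V \<and> x \<in> U \<and> y \<in> V \<and> disjnt U V"
      using openin_gtopology_ball[OF assms _ pos, of _ k] xy pos gnorm_zero[OF assms]
      by (intro exI[of _ "?B x"] exI[of _ "?B y"]) auto
  qed
qed

lemma frechet_limit_exists:
  assumes "frechet_space E" "range x \<subseteq> gcarrier E"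
    "\<And>k e. e > 0 \<Longrightarrow> \<exists>N. \<forall>m\<ge>N. \<forall>n\<ge>N. gnorm E k (x m - x n) < e"
  obtains l where "l \<in> gcarrier E" "\<And>k. (\<lambda>n. gnorm E k (x n - l)) \<longlonglongrightarrow> 0"
proof -
  have "graded E" using assms(1) unfolding frechet_space_def by blast
  obtain l where "limitin (gtopology E) x l sequentially"
    using assms unfolding frechet_space_def gcomplete_def by blast
  then show thesis using that limitin_gtopology_iff[OF \<open>graded E\<close> assms(2)] by blast
qed

section \<open>Continuity estimates for operators and functionals\<close>

lemma linear_map_on_0:
  assumes "linear_map_on V s s' T" "0 \<in> V"
  shows "T 0 = 0"
proof -
  have "T (0 + 0) = T 0 + T 0" using assms unfolding linear_map_on_def by blast
  then show ?thesis by simp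
qed

lemma linear_map_on_diff:
  assumes "linear_map_on (gcarrier E) s s' T" "graded E" "x \<in> gcarrier E" "y \<in> gcarrier E"
  shows "T (x - y) = T x - T y"
proof -
  have "T (x - y + y) = T (x - y) + T y"
    using assms graded_diff_mem[OF assms(2-4)] unfolding linear_map_on_def by blast
  then show ?thesis by simp
qed

lemma linear_map_on_sum:
  assumes "linear_map_on (gcarrier E) s s' T" "graded E" "\<And>i. i \<in> I \<Longrightarrow> f i \<in> gcarrier E"
  shows "T (sum f I) = (\<Sum>i\<in>I. T (f i))"
  using assms(3)
proof (induction I rule: infinite_finite_induct)
  case (insert a I)
  have "T (f a + sum f I) = T (f a) + T (sum f I)"
    using assms(1) insert.prems graded_sum_mem[OF assms(2), of I f] unfolding linear_map_on_def by blast
  then show ?case using insert by simp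
qed (simp_all add: linear_map_on_0[OF assms(1) graded_zero_mem[OF assms(2)]])

text \<open>The common core of \<open>operators_bounded\<close> and \<open>dual_bounded\<close>: the
  neighbourhood contains a ball of some grade \<open>r\<close>, and homogeneity of \<open>p\<close>
  spreads the bound on that ball to the whole space.\<close>

lemma linear_bounded_of_nbhd:
  fixes p :: "'e::ab_group_add \<Rightarrow> real"
  assumes "graded (E :: ('k::real_normed_field, 'e) graded_space)" "openin (gtopology E) U" "0 \<in> U" "\<And>x. x \<in> U \<Longrightarrow> p x \<le> 1"
    "\<And>c x. x \<in> gcarrier E \<Longrightarrow> p (gscale E c x) = norm c * p x"
  obtains r c where "0 \<le> c" "\<And>x. x \<in> gcarrier E \<Longrightarrow> p x \<le> c * gnorm E r x"
proof -
  obtain r e where re: "e > 0" "{y \<in> gcarrier E. gnorm E r (y - 0) < e} \<subseteq> U"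
    using assms(2,3) unfolding openin_gtopology_iff[OF assms(1)] by blast
  have "p x \<le> 2 / e" if x: "x \<in> gcarrier E" "gnorm E r x \<le> 1" for x
  proof -
    \<comment> \<open>Scaling by \<open>e / 2\<close> rather than by \<open>e\<close> keeps the
      vector strictly inside the open ball of radius \<open>e\<close>.\<close>
    define y where "y = gscale E (of_real (e / 2)) x"
    have "gnorm E r y = e / 2 * gnorm E r x"
      unfolding y_def gnorm_scale[OF assms(1) x(1)] norm_of_real using re(1) by simp
    also have "\<dots> \<le> e / 2 * 1" using x(2) re(1) by (intro mult_left_mono) auto
    finally have "gnorm E r y < e" using re(1) by simp
    then have "y \<in> U" using re(2) graded_scale_mem[OF assms(1) x(1)] y_def by auto
    then have "e / 2 * p x \<le> 1"
      using assms(4)[of y] re(1) unfolding y_def assms(5)[OF x(1)] norm_of_real by simp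
    then show ?thesis using re(1) by (simp add: field_simps)
  qed
  then have "p x \<le> 2 / e * gnorm E r x" if "x \<in> gcarrier E" for x
    using gnorm_le_scale_unit[where p = p, OF assms(1) that assms(5)] by blast
  then show thesis using that[of "2 / e" r] re(1) by simp
qed

lemma operators_bounded:
  assumes "graded E" "graded F" "T \<in> operators E F"
  obtains r c where "0 \<le> c" "\<And>x. x \<in> gcarrier E \<Longrightarrow> gnorm F k (T x) \<le> c * gnorm E r x"
proof -
  have T: "T ` gcarrier E \<subseteq> gcarrier F" "linear_map_on (gcarrier E) (gscale E) (gscale F) T"
    "continuous_map (gtopology E) (gtopology F) T"
    using assms(3) unfolding operators_def by auto
  let ?U = "{x \<in> topspace (gtopology E). T x \<in> {y \<in> gcarrier F. gnorm F k (y - 0) < 1}}"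
  have "openin (gtopology E) ?U"
    by (rule openin_continuous_map_preimage[OF T(3)], rule openin_gtopology_ball[OF assms(2)])
      (simp_all add: graded_zero_mem[OF assms(2)])
  moreover have "0 \<in> ?U"
    by (simp add: topspace_gtopology[OF assms(1)] graded_zero_mem[OF assms(1)]
        linear_map_on_0[OF T(2) graded_zero_mem[OF assms(1)]] graded_zero_mem[OF assms(2)] gnorm_zero[OF assms(2)])
  moreover have "gnorm F k (T x) \<le> 1" if "x \<in> ?U" for x using that by simp
  moreover have "gnorm F k (T (gscale E c x)) = norm c * gnorm F k (T x)" if "x \<in> gcarrier E" for c x
    using T(1,2) that gnorm_scale[OF assms(2), of "T x" k c] unfolding linear_map_on_def by auto
  ultimately show thesis
    by (rule linear_bounded_of_nbhd[where p = "\<lambda>x. gnorm F k (T x)", OF assms(1)]) (assumption | erule that, assumption)+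
qed

lemma operatorsI:
  assumes "graded E" "graded F" "T ` gcarrier E \<subseteq> gcarrier F"
    "linear_map_on (gcarrier E) (gscale E) (gscale F) T"
    "\<And>k. \<exists>r c. \<forall>x\<in>gcarrier E. gnorm F k (T x) \<le> c * gnorm E r x"
  shows "T \<in> operators E F"
proof -
  have "openin (gtopology E) {x \<in> gcarrier E. T x \<in> V}" if V: "openin (gtopology F) V" for V
    unfolding openin_gtopology_iff[OF assms(1)]
  proof (intro conjI ballI)
    fix x assume "x \<in> {x \<in> gcarrier E. T x \<in> V}"
    then have x: "x \<in> gcarrier E" "T x \<in> V" by auto
    obtain k e where ke: "e > 0" "{y \<in> gcarrier F. gnorm F k (y - T x) < e} \<subseteq> V"
      using V x(2) unfolding openin_gtopology_iff[OF assms(2)] by blast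
    obtain r c where rc: "\<forall>x\<in>gcarrier E. gnorm F k (T x) \<le> c * gnorm E r x" using assms(5) by blast
    \<comment> \<open>The constant \<open>c\<close> is an arbitrary real, possibly zero or negative;
      with \<open>\<bar>c\<bar> + 1\<close> in the denominator the radius is defined and positive in
      every case.\<close>
    have "gnorm F k (T y - T x) < e"
      if y: "y \<in> gcarrier E" "gnorm E r (y - x) < e / (\<bar>c\<bar> + 1)" for y
    proof -
      have d: "y - x \<in> gcarrier E" using graded_diff_mem[OF assms(1) y(1) x(1)] .
      have "gnorm F k (T y - T x) \<le> c * gnorm E r (y - x)"
        using rc d linear_map_on_diff[OF assms(4,1) y(1) x(1)] by metis
      also have "\<dots> \<le> (\<bar>c\<bar> + 1) * gnorm E r (y - x)"
        using gnorm_nonneg[OF assms(1) d] by (intro mult_right_mono) auto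
      also have "\<dots> < e" using y(2) by (simp add: field_simps add_pos_nonneg)
      finally show ?thesis .
    qed
    then have "{y \<in> gcarrier E. gnorm E r (y - x) < e / (\<bar>c\<bar> + 1)} \<subseteq> {x \<in> gcarrier E. T x \<in> V}"
      using ke(2) assms(3) by blast
    moreover have "e / (\<bar>c\<bar> + 1) > 0" using ke(1) by simp
    ultimately show "\<exists>k. \<exists>e>0. {y \<in> gcarrier E. gnorm E k (y - x) < e} \<subseteq> {x \<in> gcarrier E. T x \<in> V}"
      by blast
  qed blast
  then have "continuous_map (gtopology E) (gtopology F) T"
    using assms(3) unfolding continuous_map_def topspace_gtopology[OF assms(1)] topspace_gtopology[OF assms(2)]
    by blast
  then show ?thesis using assms(3,4) unfolding operators_def by blast
qed

lemma dual_bounded: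
  assumes "graded E" "u \<in> dual E"
  obtains r c where "0 \<le> c" "\<And>x. x \<in> gcarrier E \<Longrightarrow> norm (u x) \<le> c * gnorm E r x"
proof -
  have u: "linear_map_on (gcarrier E) (gscale E) (*) u" "continuous_map (gtopology E) euclidean u"
    using assms(2) unfolding dual_def by auto
  let ?U = "{x \<in> topspace (gtopology E). u x \<in> ball 0 1}"
  have "openin (gtopology E) ?U"
    by (rule openin_continuous_map_preimage[OF u(2)]) (simp add: open_openin[symmetric])
  moreover have "0 \<in> ?U"
    by (simp add: topspace_gtopology[OF assms(1)] graded_zero_mem[OF assms(1)]
        linear_map_on_0[OF u(1) graded_zero_mem[OF assms(1)]])
  moreover have "norm (u x) \<le> 1" if "x \<in> ?U" for x using that by simp
  moreover have "norm (u (gscale E c x)) = norm c * norm (u x)" if "x \<in> gcarrier E" for c x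
    using u(1) that unfolding linear_map_on_def by (auto simp: norm_mult)
  ultimately show thesis
    by (rule linear_bounded_of_nbhd[where p = "\<lambda>x. norm (u x)", OF assms(1)]) (assumption | erule that, assumption)+
qed

lemma dualI:
  assumes "graded E" "linear_map_on (gcarrier E) (gscale E) (*) u"
    "\<And>x. x \<in> gcarrier E \<Longrightarrow> norm (u x) \<le> c * gnorm E r x"
  shows "u \<in> dual E"
proof -
  have "openin (gtopology E) {x \<in> gcarrier E. u x \<in> V}" if V: "open V" for V
    unfolding openin_gtopology_iff[OF assms(1)]
  proof (intro conjI ballI)
    fix x assume "x \<in> {x \<in> gcarrier E. u x \<in> V}"
    then have x: "x \<in> gcarrier E" "u x \<in> V" by auto
    obtain e where e: "e > 0" "ball (u x) e \<subseteq> V"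
      using V x(2) openE by blast
    have "dist (u x) (u y) < e"
      if y: "y \<in> gcarrier E" "gnorm E r (y - x) < e / (\<bar>c\<bar> + 1)" for y
    proof -
      have d: "y - x \<in> gcarrier E" using graded_diff_mem[OF assms(1) y(1) x(1)] .
      have "dist (u x) (u y) \<le> c * gnorm E r (y - x)"
        using assms(3)[OF d] linear_map_on_diff[OF assms(2,1) y(1) x(1)]
        by (simp add: dist_norm norm_minus_commute)
      also have "\<dots> \<le> (\<bar>c\<bar> + 1) * gnorm E r (y - x)"
        using gnorm_nonneg[OF assms(1) d] by (intro mult_right_mono) auto
      also have "\<dots> < e" using y(2) by (simp add: field_simps add_pos_nonneg)
      finally show ?thesis .
    qed
    then have "{y \<in> gcarrier E. gnorm E r (y - x) < e / (\<bar>c\<bar> + 1)} \<subseteq> {x \<in> gcarrier E. u x \<in> V}"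
      using e(2) by auto
    moreover have "e / (\<bar>c\<bar> + 1) > 0" using e(1) by simp
    ultimately show "\<exists>k. \<exists>e>0. {y \<in> gcarrier E. gnorm E k (y - x) < e} \<subseteq> {x \<in> gcarrier E. u x \<in> V}"
      by blast
  qed blast
  then have "continuous_map (gtopology E) euclidean u"
    unfolding continuous_map_def topspace_gtopology[OF assms(1)] by (simp add: open_openin[symmetric])
  then show ?thesis using assms(2) unfolding dual_def by blast
qed

section \<open>Dual norms, operator norms and the characteristic of continuity as real
  estimates\<close>

lemma dual_norm_le_iff:
  assumes "graded E" "u \<in> dual E" "0 \<le> c"
  shows "dual_norm E r u \<le> ennreal c \<longleftrightarrow> (\<forall>x\<in>gcarrier E. norm (u x) \<le> c * gnorm E r x)"
proof -
  have "norm (u (gscale E c x)) = norm c * norm (u x)" if "x \<in> gcarrier E" for c x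
    using assms(2) that unfolding dual_def linear_map_on_def by (auto simp: norm_mult)
  then show ?thesis unfolding dual_norm_def
    by (intro SUP_unit_ball_le_iff[OF assms(1,3)]) auto
qed

lemma op_norm_le_iff:
  assumes "graded E" "graded F" "T \<in> operators E F" "0 \<le> c"
  shows "op_norm E F k r T \<le> ennreal c \<longleftrightarrow> (\<forall>x\<in>gcarrier E. gnorm F k (T x) \<le> c * gnorm E r x)"
proof -
  have T: "T x \<in> gcarrier F" if "x \<in> gcarrier E" for x
    using assms(3) that unfolding operators_def by auto
  have "gnorm F k (T (gscale E c x)) = norm c * gnorm F k (T x)" if "x \<in> gcarrier E" for c x
    using assms(3) that gnorm_scale[OF assms(2) T[OF that], of k c] unfolding operators_def linear_map_on_def by auto
  then show ?thesis unfolding op_norm_def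
    using gnorm_nonneg[OF assms(2) T] by (intro SUP_unit_ball_le_iff[OF assms(1,4)]) auto
qed

lemma dual_norm_antimono:
  assumes "graded E" "r \<le> s"
  shows "dual_norm E s u \<le> dual_norm E r u"
  unfolding dual_norm_def using gnorm_mono[OF assms(1) _ assms(2)]
  by (intro SUP_subset_mono) (auto intro: order_trans)

lemma op_norm_antimono:
  assumes "graded E" "r \<le> s"
  shows "op_norm E F k s T \<le> op_norm E F k r T"
  unfolding op_norm_def using gnorm_mono[OF assms(1) _ assms(2)]
  by (intro SUP_subset_mono) (auto intro: order_trans)

text \<open>An infimum of naturals that is at most \<open>s\<close> is attained at some
  \<open>r \<le> s\<close>, and the operator norm decreases when the grade of the domain grows from
  \<open>r\<close> to \<open>s\<close>. For an empty index set the infimum is infinite and both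
  sides fail.\<close>

lemma char_of_continuity_le_iff:
  assumes "graded E"
  shows "char_of_continuity E F T k \<le> enat s \<longleftrightarrow> op_norm E F k s T < \<infinity>"
proof
  assume L: "char_of_continuity E F T k \<le> enat s"
  have "\<exists>r\<le>s. op_norm E F k r T < \<infinity>"
  proof (rule ccontr)
    assume "\<not> ?thesis"
    then have "enat (Suc s) \<le> char_of_continuity E F T k"
      unfolding char_of_continuity_def by (auto intro!: INF_greatest simp: not_less_eq_eq[symmetric] not_le)
    from order_trans[OF this L] have "enat (Suc s) \<le> enat s" .
    then show False by simp
  qed
  then show "op_norm E F k s T < \<infinity>" using op_norm_antimono[OF assms] le_less_trans by blast
next
  assume "op_norm E F k s T < \<infinity>"
  then show "char_of_continuity E F T k \<le> enat s"
    unfolding char_of_continuity_def by (intro INF_lower) simp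
qed

section \<open>Koethe spaces\<close>

definition unit_seq :: "nat \<Rightarrow> nat \<Rightarrow> 'k::real_normed_field" where
  "unit_seq i = (\<lambda>j. if j = i then 1 else 0)"

lemma gcarrier_koethe:
  "x \<in> gcarrier (koethe_space b) \<longleftrightarrow> (\<forall>k. summable (\<lambda>j. norm (x j) * b j k))"
  and gnorm_koethe: "gnorm (koethe_space b) k x = (\<Sum>j. norm (x j) * b j k)"
  and gscale_koethe: "gscale (koethe_space b) c x = (\<lambda>j. c * x j)"
  unfolding koethe_space_def by simp_all

lemma koethe_matrix_nonneg: "koethe_matrix b \<Longrightarrow> 0 \<le> b n k"
  and koethe_matrix_pos: "koethe_matrix b \<Longrightarrow> \<exists>k. 0 < b n k"
  unfolding koethe_matrix_def by blast+

lemma koethe_matrix_mono: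
  assumes "koethe_matrix b" "k \<le> m"
  shows "b n k \<le> b n m"
proof (rule lift_Suc_mono_le[where f = "b n", OF _ assms(2)])
  show "b n k \<le> b n (Suc k)" for k using assms(1) unfolding koethe_matrix_def by blast
qed

lemma graded_koethe:
  assumes "koethe_matrix b"
  shows "graded (koethe_space b :: ('k::real_normed_field, nat \<Rightarrow> 'k) graded_space)"
proof -
  let ?K = "koethe_space b :: ('k, nat \<Rightarrow> 'k) graded_space"
  note b0 = koethe_matrix_nonneg[OF assms]
  have vs: "vector_space (gscale ?K)"
    unfolding vector_space_def gscale_koethe by (auto simp: fun_eq_iff algebra_simps)
  then have md: "module (gscale ?K)" unfolding vector_space_def module_def by simp
  have add_summable: "summable (\<lambda>j. norm (x j + y j) * b j k)"
    and add_le: "(\<Sum>j. norm (x j + y j) * b j k) \<le> (\<Sum>j. norm (x j) * b j k) + (\<Sum>j. norm (y j) * b j k)"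
    if s: "summable (\<lambda>j. norm (x j) * b j k)" "summable (\<lambda>j. norm (y j) * b j k)"
    for x y :: "nat \<Rightarrow> 'k" and k
  proof -
    have le: "norm (x j + y j) * b j k \<le> norm (x j) * b j k + norm (y j) * b j k" for j
      using mult_right_mono[OF norm_triangle_ineq b0, of "x j" "y j" j k] by (simp add: distrib_right)
    show sm: "summable (\<lambda>j. norm (x j + y j) * b j k)"
      by (rule summable_comparison_test'[OF summable_add[OF s]]) (use le b0 in simp)
    show "(\<Sum>j. norm (x j + y j) * b j k) \<le> (\<Sum>j. norm (x j) * b j k) + (\<Sum>j. norm (y j) * b j k)"
      unfolding suminf_add[OF s] by (rule suminf_le[OF le sm summable_add[OF s]])
  qed
  have scale_eq: "norm (c * x j) * b j k = norm c * (norm (x j) * b j k)" for c :: 'k and x :: "nat \<Rightarrow> 'k" and j k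
    by (simp add: norm_mult)
  have "module.subspace (gscale ?K) (gcarrier ?K)"
    unfolding module.subspace_def[OF md] gscale_koethe
    by (auto simp: gcarrier_koethe add_summable norm_mult mult.assoc intro: summable_mult)
  moreover have "gnorm ?K k (gscale ?K c x) = norm c * gnorm ?K k x" if "x \<in> gcarrier ?K" for k c x
    using that unfolding gnorm_koethe gscale_koethe gcarrier_koethe scale_eq by (intro suminf_mult) blast
  moreover have "gnorm ?K k x \<le> gnorm ?K (Suc k) x" if "x \<in> gcarrier ?K" for k x
    using that unfolding gnorm_koethe gcarrier_koethe
    by (intro suminf_le mult_left_mono koethe_matrix_mono[OF assms]) auto
  moreover have "0 \<le> gnorm ?K k x" if "x \<in> gcarrier ?K" for k x
    using that unfolding gnorm_koethe gcarrier_koethe by (intro suminf_nonneg) (auto simp: b0)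
  moreover have "gnorm ?K k (x + y) \<le> gnorm ?K k x + gnorm ?K k y"
    if "x \<in> gcarrier ?K" "y \<in> gcarrier ?K" for k x y
    using that add_le unfolding gnorm_koethe gcarrier_koethe by simp
  ultimately show ?thesis unfolding graded_def using vs by blast
qed

lemma koethe_coord_le:
  assumes "koethe_matrix b" "x \<in> gcarrier (koethe_space b)"
  shows "norm (x i) * b i k \<le> gnorm (koethe_space b) k x"
  using sum_le_suminf[of "\<lambda>j. norm (x j) * b j k" "{i}"] assms koethe_matrix_nonneg[OF assms(1)]
  unfolding gcarrier_koethe gnorm_koethe by simp

lemma unit_seq_sums: "(\<lambda>j. norm (unit_seq i j :: 'k::real_normed_field) * b j k) sums b i k"
proof -
  have "(\<lambda>j. norm (unit_seq i j :: 'k) * b j k) = (\<lambda>j. if j = i then b j k else 0)"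
    by (auto simp: unit_seq_def)
  then show ?thesis using sums_single[of i "\<lambda>j. b j k"] by simp
qed

lemma unit_seq_mem: "unit_seq i \<in> gcarrier (koethe_space b)"
  and gnorm_unit_seq: "gnorm (koethe_space b) k (unit_seq i) = b i k"
  by (simp_all add: gcarrier_koethe gnorm_koethe sums_summable[OF unit_seq_sums]
      sums_unique[OF unit_seq_sums, symmetric])

section \<open>Completeness of Koethe spaces and expansion in unit vectors\<close>

lemma frechet_koethe:
  assumes "koethe_matrix b"
  shows "frechet_space (koethe_space b :: ('k::{real_normed_field, banach}, nat \<Rightarrow> 'k) graded_space)"
proof -
  let ?K = "koethe_space b :: ('k, nat \<Rightarrow> 'k) graded_space"
  note b0 = koethe_matrix_nonneg[OF assms] and gr = graded_koethe[OF assms, where 'k = 'k]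
  have "x = 0" if x: "x \<in> gcarrier ?K" "\<And>k. gnorm ?K k x = 0" for x
  proof
    fix i
    obtain k where "0 < b i k" using koethe_matrix_pos[OF assms] by blast
    moreover have "norm (x i) * b i k \<le> 0" using koethe_coord_le[OF assms x(1), of i k] x(2) by simp
    ultimately show "x i = 0 i" by (simp add: mult_le_0_iff)
  qed
  then have H: "Hausdorff_space (gtopology ?K)" unfolding Hausdorff_gtopology_iff[OF gr] by blast
  have "\<exists>l. limitin (gtopology ?K) x l sequentially"
    if x: "range x \<subseteq> gcarrier ?K"
      and cau: "\<forall>k. \<forall>e>0. \<exists>N. \<forall>m\<ge>N. \<forall>n\<ge>N. gnorm ?K k (x m - x n) < e" for x
  proof -
    have mem: "x n \<in> gcarrier ?K" for n using x by blast
    have "Cauchy (\<lambda>n. x n j)" for j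
    proof (rule CauchyI)
      fix e :: real assume "e > 0"
      obtain k where k: "0 < b j k" using koethe_matrix_pos[OF assms] by blast
      obtain N where N: "\<forall>m\<ge>N. \<forall>n\<ge>N. gnorm ?K k (x m - x n) < e * b j k"
        using cau \<open>e > 0\<close> k by (meson mult_pos_pos)
      have "norm (x m j - x n j) < e" if "m \<ge> N" "n \<ge> N" for m n
      proof -
        have "norm (x m j - x n j) * b j k \<le> gnorm ?K k (x m - x n)"
          using koethe_coord_le[OF assms graded_diff_mem[OF gr mem mem], of m n j k] by simp
        also have "\<dots> < e * b j k" using N that by blast
        finally show ?thesis using k by simp
      qed
      then show "\<exists>M. \<forall>m\<ge>M. \<forall>n\<ge>M. norm (x m j - x n j) < e" by blast
    qed
    then have "\<forall>j. \<exists>l. (\<lambda>n. x n j) \<longlonglongrightarrow> l" using Cauchy_convergent convergent_def by blast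
    then obtain l where l: "\<And>j. (\<lambda>n. x n j) \<longlonglongrightarrow> l j" by metis
    \<comment> \<open>Coordinatewise convergence passes to the limit only in finite sums, so
      \<open>n\<close> tends to infinity for fixed \<open>J\<close> first; in \<open>tail\<close>
      the length \<open>J\<close> is unbounded.\<close>
    have fin: "(\<Sum>j<J. norm (x m j - l j) * b j k) \<le> e"
      if N: "\<forall>m\<ge>N. \<forall>n\<ge>N. gnorm ?K k (x m - x n) < e" "m \<ge> N" for k e N m J
    proof (rule tendsto_upperbound)
      show "(\<lambda>n. \<Sum>j<J. norm (x m j - x n j) * b j k) \<longlonglongrightarrow> (\<Sum>j<J. norm (x m j - l j) * b j k)"
        by (intro tendsto_intros l)
      have "(\<Sum>j<J. norm (x m j - x n j) * b j k) \<le> e" if "n \<ge> N" for n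
      proof -
        have "summable (\<lambda>j. norm ((x m - x n) j) * b j k)"
          using graded_diff_mem[OF gr mem mem] unfolding gcarrier_koethe by blast
        then have "(\<Sum>j<J. norm ((x m - x n) j) * b j k) \<le> gnorm ?K k (x m - x n)"
          unfolding gnorm_koethe by (intro sum_le_suminf) (auto simp: b0)
        also have "\<dots> < e" using N that by blast
        finally show ?thesis by simp
      qed
      then show "\<forall>\<^sub>F n in sequentially. (\<Sum>j<J. norm (x m j - x n j) * b j k) \<le> e"
        unfolding eventually_sequentially by blast
    qed simp
    have tail: "summable (\<lambda>j. norm (x m j - l j) * b j k)" "(\<Sum>j. norm (x m j - l j) * b j k) \<le> e"
      if N: "\<forall>m\<ge>N. \<forall>n\<ge>N. gnorm ?K k (x m - x n) < e" "m \<ge> N" for k e N m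
      using fin[OF N] by (auto intro!: summableI_nonneg_bounded suminf_le_const simp: b0)
    have "summable (\<lambda>j. norm (l j) * b j k)" for k
    proof -
      obtain N where N: "\<forall>m\<ge>N. \<forall>n\<ge>N. gnorm ?K k (x m - x n) < 1" using cau zero_less_one by blast
      have s1: "summable (\<lambda>j. norm (x N j) * b j k)" using mem unfolding gcarrier_koethe by blast
      have "norm (l j) * b j k \<le> norm (x N j) * b j k + norm (x N j - l j) * b j k" for j
        using mult_right_mono[OF norm_triangle_ineq2 b0, of "l j" "x N j" j k]
        by (simp add: algebra_simps norm_minus_commute)
      then show ?thesis
        by (intro summable_comparison_test'[OF summable_add[OF s1 tail(1)[OF N order_refl]]]) (simp add: b0)
    qed
    then have lm: "l \<in> gcarrier ?K" unfolding gcarrier_koethe by blast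
    have "(\<lambda>n. gnorm ?K k (x n - l)) \<longlonglongrightarrow> 0" for k
    proof (rule LIMSEQ_I)
      fix e :: real assume "e > 0"
      then obtain N where N: "\<forall>m\<ge>N. \<forall>n\<ge>N. gnorm ?K k (x m - x n) < e / 2" using cau half_gt_zero by blast
      have "norm (gnorm ?K k (x n - l) - 0) < e" if "n \<ge> N" for n
        using tail(2)[OF N that] gnorm_nonneg[OF gr graded_diff_mem[OF gr mem lm], of k n] \<open>e > 0\<close>
        unfolding gnorm_koethe by simp
      then show "\<exists>N. \<forall>n\<ge>N. norm (gnorm ?K k (x n - l) - 0) < e" by blast
    qed
    then show ?thesis using limitin_gtopology_iff[OF gr x] lm by blast
  qed
  then show ?thesis unfolding frechet_space_def gcomplete_def using gr H by blast
qed

text \<open>Subtracting the partial sum deletes exactly the coordinates below \<open>N\<close>, so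
  the seminorm of the remainder is the tail of a convergent series.\<close>

lemma koethe_expansion:
  assumes "koethe_matrix b" "x \<in> gcarrier (koethe_space b)"
  shows "(\<lambda>N. gnorm (koethe_space b) k (x - (\<Sum>i<N. gscale (koethe_space b) (x i) (unit_seq i)))) \<longlonglongrightarrow> 0"
proof -
  have s: "summable (\<lambda>j. norm (x j) * b j k)" using assms(2) unfolding gcarrier_koethe by blast
  have sum_app: "(sum f I) j = (\<Sum>i\<in>I. f i j)" for f :: "nat \<Rightarrow> nat \<Rightarrow> 'a" and I j
    by (induction I rule: infinite_finite_induct) auto
  have "(\<Sum>i<N. gscale (koethe_space b) (x i) (unit_seq i)) j = (if j < N then x j else 0)" for N j
    unfolding sum_app gscale_koethe unit_seq_def by (simp add: sum.delta' if_distrib cong: if_cong)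
  then have "gnorm (koethe_space b) k (x - (\<Sum>i<N. gscale (koethe_space b) (x i) (unit_seq i)))
      = (\<Sum>j. norm (x j) * b j k - (if j < N then norm (x j) * b j k else 0))" for N
    unfolding gnorm_koethe by (intro arg_cong[where f = suminf] ext) simp
  moreover have "(\<lambda>j. norm (x j) * b j k - (if j < N then norm (x j) * b j k else 0)) sums
      ((\<Sum>j. norm (x j) * b j k) - (\<Sum>j<N. norm (x j) * b j k))" for N
    using sums_If_finite_set[of "{..<N}" "\<lambda>j. norm (x j) * b j k"]
    by (intro sums_diff summable_sums[OF s]) simp
  ultimately have "gnorm (koethe_space b) k (x - (\<Sum>i<N. gscale (koethe_space b) (x i) (unit_seq i)))
      = (\<Sum>j. norm (x j) * b j k) - (\<Sum>j<N. norm (x j) * b j k)" for N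
    by (simp add: sums_iff)
  then show ?thesis
    using tendsto_diff[OF tendsto_const summable_LIMSEQ[OF s], of "\<Sum>j. norm (x j) * b j k"] by simp
qed

section \<open>Nuclear Koethe spaces: the Grothendieck-Pietsch criterion\<close>

lemma suminf_swap_ennreal: "(\<Sum>i. \<Sum>n. a i n) = (\<Sum>n. \<Sum>i. a i n :: ennreal)"
  using nn_integral_suminf[of "\<lambda>n i. a i n" "count_space UNIV"] by (simp add: nn_integral_count_space_nat)

text \<open>The Grothendieck-Pietsch criterion: reading the nuclear expansion of the \<open>i\<close>-th unit vector in
  its \<open>i\<close>-th coordinate bounds \<open>b i k / b i m\<close> by the \<open>i\<close>-th terms of the series of nuclear norms.\<close>

lemma nuclear_koethe_summable:
  assumes "koethe_matrix b" "nuclear (koethe_space b :: ('k::real_normed_field, nat \<Rightarrow> 'k) graded_space)"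
  obtains m where "k \<le> m" "(\<Sum>i. ennreal (b i k) / ennreal (b i m)) < \<infinity>"
proof -
  let ?K = "koethe_space b :: ('k, nat \<Rightarrow> 'k) graded_space"
  note b0 = koethe_matrix_nonneg[OF assms(1)] and gr = graded_koethe[OF assms(1), where 'k = 'k]
  obtain m f y where m: "k \<le> m"
    and f: "\<And>n. f n \<in> dual ?K" "\<And>n. dual_norm ?K m (f n) < \<infinity>" and y: "\<And>n. y n \<in> gcarrier ?K"
    and fin: "(\<Sum>n. dual_norm ?K m (f n) * ennreal (gnorm ?K k (y n))) < \<infinity>"
    and ex: "\<And>x. x \<in> gcarrier ?K \<Longrightarrow> (\<lambda>N. gnorm ?K k (x - (\<Sum>n<N. gscale ?K (f n x) (y n)))) \<longlonglongrightarrow> 0"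
    using assms(2) unfolding nuclear_def by meson
  define D where "D n = enn2real (dual_norm ?K m (f n))" for n
  have D: "ennreal (D n) = dual_norm ?K m (f n)" "0 \<le> D n" for n
    using f(2)[of n] by (simp_all add: D_def)
  have fe: "norm (f n (unit_seq i)) \<le> D n * b i m" for n i
  proof -
    have "\<forall>x\<in>gcarrier ?K. norm (f n x) \<le> D n * gnorm ?K m x"
      using dual_norm_le_iff[OF gr f(1) D(2)] D(1)[of n] by (metis order_refl)
    from bspec[OF this unit_seq_mem] show ?thesis by (simp add: gnorm_unit_seq)
  qed
  have sum_app: "(sum g I) j = (\<Sum>i\<in>I. g i j)" for g :: "nat \<Rightarrow> nat \<Rightarrow> 'k" and I j
    by (induction I rule: infinite_finite_induct) auto
  have key: "ennreal (b i k) / ennreal (b i m) \<le> (\<Sum>n. ennreal (D n) * ennreal (norm (y n i) * b i k))" for i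
  proof (cases "b i k = 0")
    case False
    then have bk: "b i k > 0" using b0[of i k] by simp
    then have bm: "b i m > 0" using koethe_matrix_mono[OF assms(1) m, of i] by simp
    \<comment> \<open>The remainder of the nuclear expansion is known to vanish only in the
      \<open>k\<close>-th seminorm. Its \<open>i\<close>-th coordinate is therefore multiplied by
      \<open>b i k\<close> below, which that seminorm dominates.\<close>
    define r where "r N = unit_seq i - (\<Sum>n<N. gscale ?K (f n (unit_seq i)) (y n))" for N
    have r: "r N \<in> gcarrier ?K" for N
      unfolding r_def by (intro graded_mem[OF gr] unit_seq_mem y)
    have "b i k / b i m \<le> gnorm ?K k (r N) / b i m + (\<Sum>n<N. D n * (norm (y n i) * b i k))" for N
    proof -
      have "1 = r N i + (\<Sum>n<N. f n (unit_seq i) * y n i)"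
        unfolding r_def sum_app gscale_koethe by (simp add: sum_app gscale_koethe unit_seq_def)
      then have "1 \<le> norm (r N i) + norm (\<Sum>n<N. f n (unit_seq i) * y n i)"
        by (metis norm_one norm_triangle_ineq)
      also have "norm (\<Sum>n<N. f n (unit_seq i) * y n i) \<le> (\<Sum>n<N. D n * b i m * norm (y n i))"
        by (rule sum_norm_le) (simp add: norm_mult mult_right_mono fe)
      finally have "b i k \<le> (norm (r N i) + (\<Sum>n<N. D n * b i m * norm (y n i))) * b i k"
        using bk by simp
      also have "\<dots> = norm (r N i) * b i k + (\<Sum>n<N. D n * b i m * norm (y n i)) * b i k"
        by (simp add: distrib_right)
      also have "\<dots> \<le> gnorm ?K k (r N) + (\<Sum>n<N. D n * b i m * norm (y n i)) * b i k"
        using koethe_coord_le[OF assms(1) r] by (rule add_right_mono)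
      finally have "b i k \<le> gnorm ?K k (r N) + (\<Sum>n<N. D n * (norm (y n i) * b i k)) * b i m"
        by (simp add: sum_distrib_left sum_distrib_right mult_ac)
      then show ?thesis using bm by (simp add: field_simps)
    qed
    then have "ennreal (b i k / b i m) \<le> ennreal (gnorm ?K k (r N) / b i m)
        + (\<Sum>n. ennreal (D n) * ennreal (norm (y n i) * b i k))" (is "_ \<le> _ + ?S") for N
    proof -
      have "ennreal (b i k / b i m) \<le> ennreal (gnorm ?K k (r N) / b i m + (\<Sum>n<N. D n * (norm (y n i) * b i k)))"
        using \<open>\<And>N. b i k / b i m \<le> _ N\<close> by (rule ennreal_leI)
      also have "\<dots> = ennreal (gnorm ?K k (r N) / b i m) + ennreal (\<Sum>n<N. D n * (norm (y n i) * b i k))"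
        using bm gnorm_nonneg[OF gr r] by (intro ennreal_plus sum_nonneg divide_nonneg_pos) (simp_all add: D(2) b0)
      also have "ennreal (\<Sum>n<N. D n * (norm (y n i) * b i k))
          = (\<Sum>n<N. ennreal (D n) * ennreal (norm (y n i) * b i k))"
        by (subst sum_ennreal[symmetric]) (simp_all add: D(2) b0 ennreal_mult)
      also have "ennreal (gnorm ?K k (r N) / b i m) + (\<Sum>n<N. ennreal (D n) * ennreal (norm (y n i) * b i k))
          \<le> ennreal (gnorm ?K k (r N) / b i m) + ?S"
        by (intro add_left_mono sum_le_suminf) auto
      finally show ?thesis .
    qed
    \<comment> \<open>The finite sums were replaced by the full series \<open>?S\<close>, so only
      the remainder still depends on \<open>N\<close>.\<close>
    moreover have "(\<lambda>N. ennreal (gnorm ?K k (r N) / b i m) + ?S) \<longlonglongrightarrow> ennreal (0 / b i m) + ?S"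
      using ex[OF unit_seq_mem, of i] bm unfolding r_def[symmetric]
      by (intro tendsto_add tendsto_const tendsto_ennrealI tendsto_divide) auto
    ultimately have "ennreal (b i k / b i m) \<le> ennreal (0 / b i m) + ?S"
      by (intro LIMSEQ_le_const) auto
    then show ?thesis using bm b0 by (simp add: divide_ennreal)
  qed simp
  \<comment> \<open>After exchanging the two sums, the sum over \<open>i\<close> is the
    \<open>k\<close>-th seminorm of \<open>y n\<close>, which leaves the convergent series of
    nuclear norms.\<close>
  have "(\<Sum>i. ennreal (b i k) / ennreal (b i m)) \<le> (\<Sum>i. \<Sum>n. ennreal (D n) * ennreal (norm (y n i) * b i k))"
    by (intro suminf_le key) auto
  also have "\<dots> = (\<Sum>n. ennreal (D n) * (\<Sum>i. ennreal (norm (y n i) * b i k)))"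
    by (subst suminf_swap_ennreal) simp
  also have "\<dots> = (\<Sum>n. dual_norm ?K m (f n) * ennreal (gnorm ?K k (y n)))"
  proof -
    have "(\<Sum>i. ennreal (norm (y n i) * b i k)) = ennreal (gnorm ?K k (y n))" for n
      using y[of n] unfolding gcarrier_koethe gnorm_koethe by (intro suminf_ennreal2) (auto simp: b0)
    then show ?thesis by (simp add: D(1))
  qed
  also have "\<dots> < \<infinity>" by (rule fin)
  finally show thesis using that m by blast
qed

section \<open>From the estimate to tame factorization\<close>

text \<open>The estimate at one grade \<open>k\<close>, with \<open>s\<close> for
  \<open>S k\<close>. The left side is the norm from grade \<open>s\<close> to grade
  \<open>k\<close> of the rank one operator given by \<open>u\<close> and \<open>z\<close>. Factored
  through the \<open>i\<close>-th unit vector, its two factors have the norms from grade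
  \<open>\<phi> q\<close> to grade \<open>q\<close> that appear in the first and in the second
  maximum.\<close>

definition rank_one_estimate ::
    "('k::real_normed_field, 'e::ab_group_add) graded_space \<Rightarrow> ('k, 'f::ab_group_add) graded_space \<Rightarrow>
     (nat \<Rightarrow> nat \<Rightarrow> real) \<Rightarrow> (nat \<Rightarrow> nat) \<Rightarrow> nat \<Rightarrow> nat \<Rightarrow> nat \<Rightarrow> real \<Rightarrow> bool" where
  "rank_one_estimate E F b \<phi> s k n C \<longleftrightarrow>
    (\<forall>u\<in>dual E. \<forall>z\<in>gcarrier F. \<forall>i.
      dual_norm E s u * ennreal (gnorm F k z)
        \<le> ennreal C * max_prod
            (MAX q\<in>{..n}. dual_norm E (\<phi> q) u * ennreal (b i q))
            (MAX q\<in>{..n}. ennreal (gnorm F q z) / ennreal (b i (\<phi> q))))"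

text \<open>Finite bounds rule out the infinite branch, so \<open>max_prod\<close> is the ordinary
  product here.\<close>

lemma max_prod_le:
  assumes "x \<le> a" "y \<le> c" "a < \<infinity>" "c < \<infinity>"
  shows "max_prod x y \<le> a * c"
  using assms unfolding max_prod_def by (auto intro: mult_mono simp: top_unique)

text \<open>Finite sums, unlike maxima, commute with the later summation over the coordinate
  \<open>i\<close>.\<close>

lemma Max_le_sum_ennreal:
  fixes f :: "nat \<Rightarrow> ennreal"
  shows "(MAX q\<in>{..n}. f q) \<le> (\<Sum>q\<le>n. f q)"
  by (intro Max.boundedI) (auto intro: member_le_sum)

lemma ennreal_inverse_antimono: "a \<le> c \<Longrightarrow> inverse c \<le> inverse (a :: ennreal)"
  including ennreal.lifting by transfer (rule ereal_inverse_antimono)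

lemma ennreal_divide_antimono: "a \<le> c \<Longrightarrow> x / c \<le> x / (a :: ennreal)"
  unfolding divide_ennreal_def by (intro mult_left_mono ennreal_inverse_antimono) auto

lemma tame_factorization_of_estimate:
  fixes E :: "('k::real_normed_field, 'e::ab_group_add) graded_space"
    and F :: "('k, 'f::ab_group_add) graded_space"
  assumes E: "graded E" and F: "graded F" and b: "koethe_matrix b"
    and nuc: "nuclear (koethe_space b :: ('k, nat \<Rightarrow> 'k) graded_space)"
    and S: "mono S"
    and est: "\<And>\<phi> :: nat \<Rightarrow> nat. mono \<phi> \<Longrightarrow>
      \<exists>k0. \<forall>k\<ge>k0. \<exists>q C. C > 0 \<and> rank_one_estimate E F b \<phi> (S k) k q C"
  shows "tame_factorization E (koethe_space b :: ('k, nat \<Rightarrow> 'k) graded_space) F"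
proof -
  let ?K = "koethe_space b :: ('k, nat \<Rightarrow> 'k) graded_space"
  note b0 = koethe_matrix_nonneg[OF b] and gr = graded_koethe[OF b, where 'k = 'k]
  have "\<exists>k0. \<forall>k\<ge>k0. char_of_continuity E F T k \<le> enat (S k)" if T: "T \<in> factoring_operators E ?K F" for T
  proof -
    obtain Q R where Top: "T \<in> operators E F" and Q: "Q \<in> operators E ?K" and R: "R \<in> operators ?K F"
      and TRQ: "\<And>x. x \<in> gcarrier E \<Longrightarrow> T x = R (Q x)"
      using T unfolding factoring_operators_def by blast
    have Tm: "T x \<in> gcarrier F" if "x \<in> gcarrier E" for x using Top that unfolding operators_def by blast
    have Qm: "Q x \<in> gcarrier ?K" if "x \<in> gcarrier E" for x using Q that unfolding operators_def by blast
    have Ql: "linear_map_on (gcarrier E) (gscale E) (gscale ?K) Q" using Q unfolding operators_def by blast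
    have Rm: "R y \<in> gcarrier F" if "y \<in> gcarrier ?K" for y using R that unfolding operators_def by blast
    have Rl: "linear_map_on (gcarrier ?K) (gscale ?K) (gscale F) R" using R unfolding operators_def by blast
    have Rs: "R (gscale ?K c y) = gscale F c (R y)" if "y \<in> gcarrier ?K" for c y
      using Rl that unfolding linear_map_on_def by blast
    have "\<forall>q. \<exists>r c. 0 \<le> c \<and> (\<forall>x\<in>gcarrier E. gnorm ?K q (Q x) \<le> c * gnorm E r x)"
      using operators_bounded[OF E gr Q] by metis
    then obtain rQ cQ where cQ: "\<And>q. 0 \<le> cQ q"
      and Qb: "\<And>q x. x \<in> gcarrier E \<Longrightarrow> gnorm ?K q (Q x) \<le> cQ q * gnorm E (rQ q) x" by metis
    have "\<forall>q. \<exists>r c. 0 \<le> c \<and> (\<forall>y\<in>gcarrier ?K. gnorm F q (R y) \<le> c * gnorm ?K r y)"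
      using operators_bounded[OF gr F R] by metis
    then obtain rR cR where cR: "\<And>q. 0 \<le> cR q"
      and Rb: "\<And>q y. y \<in> gcarrier ?K \<Longrightarrow> gnorm F q (R y) \<le> cR q * gnorm ?K (rR q) y" by metis
    have "\<forall>k. \<exists>m\<ge>k. (\<Sum>i. ennreal (b i k) / ennreal (b i m)) < \<infinity>"
      using nuclear_koethe_summable[OF b nuc] by metis
    then obtain g where g: "\<And>k. (\<Sum>i. ennreal (b i k) / ennreal (b i (g k))) < \<infinity>" by metis
    \<comment> \<open>Summing over \<open>p \<le> q\<close> makes \<open>\<phi>\<close>
      nondecreasing. It dominates \<open>rQ\<close>, which bounds the coordinate functionals of the
      first factor, and \<open>g (rR q)\<close>, which makes the quotients of
      \<open>b i (rR q)\<close> by \<open>b i (\<phi> q)\<close> summable over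
      \<open>i\<close>.\<close>
    define \<phi> where "\<phi> q = (\<Sum>p\<le>q. rQ p + g (rR p))" for q
    have mono: "mono \<phi>" unfolding \<phi>_def by (intro monoI sum_mono2) auto
    have phi: "rQ q + g (rR q) \<le> \<phi> q" for q
      unfolding \<phi>_def by (intro member_le_sum) auto
    obtain k0 where k0: "\<And>k. k \<ge> k0 \<Longrightarrow> \<exists>q C. C > 0 \<and> rank_one_estimate E F b \<phi> (S k) k q C"
      using est[OF mono] by blast
    define u where "u i x = Q x i" for i x
    define z where "z i = R (unit_seq i)" for i
    have zm: "z i \<in> gcarrier F" for i unfolding z_def by (intro Rm unit_seq_mem)
    have u_le: "norm (u i x) * b i q \<le> cQ q * gnorm E (rQ q) x" if "x \<in> gcarrier E" for i q x
      using koethe_coord_le[OF b Qm[OF that], of i q] Qb[OF that, of q] unfolding u_def by simp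
    have ul: "linear_map_on (gcarrier E) (gscale E) (*) (u i)" for i
      using Ql unfolding linear_map_on_def u_def gscale_koethe by simp
    have u_dual: "u i \<in> dual E" for i
    proof -
      obtain k where k: "0 < b i k" using koethe_matrix_pos[OF b] by blast
      have "norm (u i x) \<le> cQ k / b i k * gnorm E (rQ k) x" if "x \<in> gcarrier E" for x
        using u_le[OF that, of i k] k by (simp add: field_simps)
      then show ?thesis by (rule dualI[OF E ul])
    qed
    \<comment> \<open>For \<open>b i q = 0\<close> the left side vanishes even if the dual norm is
      infinite, by the convention inside a single term.\<close>
    have u_norm: "dual_norm E (\<phi> q) (u i) * ennreal (b i q) \<le> ennreal (cQ q)" for i q
    proof (cases "b i q = 0")
      case False
      then have bq: "b i q > 0" using b0[of i q] by simp
      have c: "0 \<le> cQ q / b i q" using cQ bq by simp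
      have "norm (u i x) \<le> cQ q / b i q * gnorm E (rQ q) x" if "x \<in> gcarrier E" for x
        using u_le[OF that, of i q] bq by (simp add: field_simps)
      then have "dual_norm E (rQ q) (u i) \<le> ennreal (cQ q / b i q)"
        using dual_norm_le_iff[OF E u_dual c] by blast
      then have "dual_norm E (\<phi> q) (u i) \<le> ennreal (cQ q / b i q)"
        using dual_norm_antimono[OF E, of "rQ q" "\<phi> q" "u i"] phi[of q] by simp
      then have "dual_norm E (\<phi> q) (u i) * ennreal (b i q) \<le> ennreal (cQ q / b i q) * ennreal (b i q)"
        by (rule mult_right_mono) simp
      also have "\<dots> = ennreal (cQ q)" using bq c by (simp flip: ennreal_mult)
      finally show ?thesis .
    qed simp
    have z_norm: "ennreal (gnorm F q (z i)) / ennreal (b i (\<phi> q))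
        \<le> ennreal (cR q) * (ennreal (b i (rR q)) / ennreal (b i (g (rR q))))" for i q
    proof -
      have "gnorm F q (z i) \<le> cR q * b i (rR q)"
        using Rb[OF unit_seq_mem, of q i] unfolding z_def gnorm_unit_seq .
      then have "ennreal (gnorm F q (z i)) \<le> ennreal (cR q) * ennreal (b i (rR q))"
        using cR b0 by (simp add: ennreal_mult[symmetric] ennreal_leI)
      then have "ennreal (gnorm F q (z i)) / ennreal (b i (\<phi> q))
          \<le> ennreal (cR q) * ennreal (b i (rR q)) / ennreal (b i (\<phi> q))"
        by (rule divide_right_mono_ennreal)
      also have "\<dots> \<le> ennreal (cR q) * ennreal (b i (rR q)) / ennreal (b i (g (rR q)))"
        using phi[of q] by (intro ennreal_divide_antimono ennreal_leI koethe_matrix_mono[OF b]) simp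
      finally show ?thesis by (simp add: ennreal_times_divide)
    qed
    have "op_norm E F k (S k) T < \<infinity>" if kk: "k \<ge> k0" for k
    proof -
      obtain qk C where C: "C > 0" and re: "rank_one_estimate E F b \<phi> (S k) k qk C"
        using k0[OF kk] by blast
      \<comment> \<open>\<open>L i\<close> is the norm of the \<open>i\<close>-th rank one term from
        grade \<open>S k\<close> to grade \<open>k\<close>. \<open>MA\<close> bounds the first
        maximum uniformly in \<open>i\<close>; \<open>MB\<close> bounds the second one and is
        summable by the choice of \<open>g\<close>.\<close>
      define L where "L i = dual_norm E (S k) (u i) * ennreal (gnorm F k (z i))" for i
      define MA where "MA = (\<Sum>q\<le>qk. ennreal (cQ q))"
      define MB where "MB i = (\<Sum>q\<le>qk. ennreal (cR q) * (ennreal (b i (rR q)) / ennreal (b i (g (rR q)))))" for i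
      have MA: "MA < \<infinity>" unfolding MA_def by simp
      have "(\<Sum>i. MB i) = (\<Sum>q\<le>qk. ennreal (cR q) * (\<Sum>i. ennreal (b i (rR q)) / ennreal (b i (g (rR q)))))"
        unfolding MB_def by (subst suminf_sum) simp_all
      also have "\<dots> < \<infinity>" using g by (auto simp: ennreal_mult_less_top)
      finally have MBs: "(\<Sum>i. MB i) < \<infinity>" .
      have MB: "MB i < \<infinity>" for i
        using sum_le_suminf[of MB "{i}"] MBs by (simp add: le_less_trans)
      have L: "L i \<le> ennreal C * (MA * MB i)" for i
      proof -
        have "(MAX q\<in>{..qk}. dual_norm E (\<phi> q) (u i) * ennreal (b i q)) \<le> MA"
          unfolding MA_def by (intro order_trans[OF Max_le_sum_ennreal] sum_mono u_norm)
        moreover have "(MAX q\<in>{..qk}. ennreal (gnorm F q (z i)) / ennreal (b i (\<phi> q))) \<le> MB i"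
          unfolding MB_def by (intro order_trans[OF Max_le_sum_ennreal] sum_mono z_norm)
        ultimately have "max_prod (MAX q\<in>{..qk}. dual_norm E (\<phi> q) (u i) * ennreal (b i q))
            (MAX q\<in>{..qk}. ennreal (gnorm F q (z i)) / ennreal (b i (\<phi> q))) \<le> MA * MB i"
          using MA MB by (intro max_prod_le)
        then have "ennreal C * max_prod (MAX q\<in>{..qk}. dual_norm E (\<phi> q) (u i) * ennreal (b i q))
            (MAX q\<in>{..qk}. ennreal (gnorm F q (z i)) / ennreal (b i (\<phi> q))) \<le> ennreal C * (MA * MB i)"
          by (rule mult_left_mono) simp
        moreover have "L i \<le> ennreal C * max_prod (MAX q\<in>{..qk}. dual_norm E (\<phi> q) (u i) * ennreal (b i q))
            (MAX q\<in>{..qk}. ennreal (gnorm F q (z i)) / ennreal (b i (\<phi> q)))"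
          using re u_dual zm unfolding rank_one_estimate_def L_def by blast
        ultimately show ?thesis by (rule order_trans[rotated])
      qed
      have "(\<Sum>i. L i) \<le> (\<Sum>i. ennreal C * (MA * MB i))" by (intro suminf_le L) auto
      also have "\<dots> = ennreal C * (MA * (\<Sum>i. MB i))" by simp
      also have "\<dots> < \<infinity>" using MA MBs by (simp add: ennreal_mult_less_top)
      finally have Lfin: "(\<Sum>i. L i) < \<infinity>" .
      have "ennreal (gnorm F k (T x)) \<le> (\<Sum>i. L i)" if x: "x \<in> gcarrier E" "gnorm E (S k) x \<le> 1" for x
      proof -
        let ?P = "\<lambda>N. \<Sum>i<N. gscale ?K (Q x i) (unit_seq i)"
        let ?D = "\<lambda>N. Q x - ?P N"
        have Pm: "?P N \<in> gcarrier ?K" and Dm: "?D N \<in> gcarrier ?K" for N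
          by (intro graded_mem[OF gr] Qm x(1) unit_seq_mem)+
        have RP: "R (?P N) = (\<Sum>i<N. gscale F (u i x) (z i))" for N
        proof -
          have "R (?P N) = (\<Sum>i<N. R (gscale ?K (Q x i) (unit_seq i)))"
            by (rule linear_map_on_sum[OF Rl gr]) (intro graded_mem[OF gr] unit_seq_mem)
          also have "\<dots> = (\<Sum>i<N. gscale F (u i x) (z i))"
            unfolding u_def z_def by (simp add: Rs[OF unit_seq_mem])
          finally show ?thesis .
        qed
        \<comment> \<open>The remainder is estimated by the continuity of \<open>R\<close> alone.
          The grade \<open>rR k\<close> is unrelated to \<open>S k\<close>, but this term disappears
          as \<open>N\<close> grows and does not enter the final bound.\<close>
        have "ennreal (gnorm F k (T x)) \<le> ennreal (cR k * gnorm ?K (rR k) (?D N)) + (\<Sum>i. L i)" for N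
        proof -
          have "gnorm F k (T x) \<le> gnorm F k (R (?P N)) + gnorm F k (T x - R (?P N))"
            by (rule gnorm_le_add_diff[OF F Tm[OF x(1)] Rm[OF Pm]])
          also have "T x - R (?P N) = R (?D N)"
            using linear_map_on_diff[OF Rl gr Qm[OF x(1)] Pm] TRQ[OF x(1)] by simp
          also have "gnorm F k (R (?P N)) \<le> (\<Sum>i<N. gnorm F k (gscale F (u i x) (z i)))"
            unfolding RP by (rule gnorm_sum_le[OF F]) (rule graded_scale_mem[OF F zm])
          also have "\<dots> = (\<Sum>i<N. norm (u i x) * gnorm F k (z i))"
            by (simp add: gnorm_scale[OF F zm])
          finally have "gnorm F k (T x) \<le> cR k * gnorm ?K (rR k) (?D N) + (\<Sum>i<N. norm (u i x) * gnorm F k (z i))"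
            using Rb[OF Dm, of k N] by linarith
          then have "ennreal (gnorm F k (T x))
              \<le> ennreal (cR k * gnorm ?K (rR k) (?D N) + (\<Sum>i<N. norm (u i x) * gnorm F k (z i)))"
            by (rule ennreal_leI)
          also have "\<dots> = ennreal (cR k * gnorm ?K (rR k) (?D N)) + ennreal (\<Sum>i<N. norm (u i x) * gnorm F k (z i))"
            by (intro ennreal_plus sum_nonneg mult_nonneg_nonneg gnorm_nonneg[OF gr Dm] gnorm_nonneg[OF F zm])
              (simp_all add: cR)
          also have "ennreal (\<Sum>i<N. norm (u i x) * gnorm F k (z i))
              = (\<Sum>i<N. ennreal (norm (u i x)) * ennreal (gnorm F k (z i)))"
            using gnorm_nonneg[OF F zm] by (subst sum_ennreal[symmetric]) (simp_all add: ennreal_mult)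
          also have "\<dots> \<le> (\<Sum>i<N. L i)"
            unfolding L_def dual_norm_def using x by (intro sum_mono mult_right_mono SUP_upper) auto
          also have "\<dots> \<le> (\<Sum>i. L i)" by (intro sum_le_suminf) auto
          finally show ?thesis by this (rule add_left_mono, assumption)+
        qed
        moreover have "(\<lambda>N. ennreal (cR k * gnorm ?K (rR k) (?D N)) + (\<Sum>i. L i)) \<longlonglongrightarrow> ennreal (cR k * 0) + (\<Sum>i. L i)"
          by (intro tendsto_add tendsto_const tendsto_ennrealI tendsto_mult koethe_expansion[OF b Qm[OF x(1)]])
        ultimately have "ennreal (gnorm F k (T x)) \<le> ennreal (cR k * 0) + (\<Sum>i. L i)"
          by (intro LIMSEQ_le_const) auto
        then show ?thesis by simp
      qed
      then have "op_norm E F k (S k) T \<le> (\<Sum>i. L i)" unfolding op_norm_def by (intro SUP_least) auto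
      then show ?thesis using Lfin by (rule le_less_trans)
    qed
    then show ?thesis using char_of_continuity_le_iff[OF E] by blast
  qed
  then show ?thesis unfolding tame_factorization_def using S by blast
qed

section \<open>Series of operators and a Baire argument\<close>

lemma tendsto_tail_0:
  fixes a :: "nat \<Rightarrow> real"
  assumes "summable a"
  shows "(\<lambda>n. \<Sum>j. a (j + n)) \<longlonglongrightarrow> 0"
  using tendsto_diff[OF tendsto_const summable_LIMSEQ[OF assms], of "suminf a"]
  by (simp add: suminf_minus_initial_segment[OF assms])

text \<open>Used to verify identities between limits of partial sums: an error dominated at every
  grade by a null sequence vanishes because the space is Hausdorff.\<close>

lemma frechet_eq_0:
  assumes "frechet_space F" "d \<in> gcarrier F" "\<And>k. \<exists>h. h \<longlonglongrightarrow> 0 \<and> (\<forall>n::nat. gnorm F k d \<le> h n)"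
  shows "d = 0"
proof -
  have F: "graded F" "Hausdorff_space (gtopology F)" using assms(1) unfolding frechet_space_def by auto
  have "gnorm F k d = 0" for k
  proof -
    obtain h where "h \<longlonglongrightarrow> 0" "\<forall>n. gnorm F k d \<le> h n" using assms(3) by blast
    then have "gnorm F k d \<le> 0" by (intro LIMSEQ_le_const) auto
    then show ?thesis using gnorm_nonneg[OF F(1) assms(2), of k] by simp
  qed
  then show ?thesis using F(2) assms(2) unfolding Hausdorff_gtopology_iff[OF F(1)] by blast
qed

text \<open>At each point the partial sums are Cauchy, since their differences are bounded by tails
  of a summable series. The grade \<open>\<phi> q\<close> does not depend on \<open>j\<close>, so
  the limit is continuous: the tail estimate with \<open>n = 0\<close> is its continuity
  estimate.\<close>

lemma operator_series:
  fixes T :: "nat \<Rightarrow> 'e::ab_group_add \<Rightarrow> 'f::ab_group_add"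
    and E :: "('k::real_normed_field, 'e) graded_space" and F :: "('k, 'f) graded_space"
  assumes E: "graded E" and F: "frechet_space F"
    and Tm: "\<And>j x. x \<in> gcarrier E \<Longrightarrow> T j x \<in> gcarrier F"
    and Tl: "\<And>j. linear_map_on (gcarrier E) (gscale E) (gscale F) (T j)"
    and Tb: "\<And>j q x. x \<in> gcarrier E \<Longrightarrow> gnorm F q (T j x) \<le> a j q * gnorm E (\<phi> q) x"
    and a: "\<And>j q. 0 \<le> a j q" "\<And>q. summable (\<lambda>j. a j q)"
  obtains V where "V \<in> operators E F"
    "\<And>n q x. x \<in> gcarrier E \<Longrightarrow>
      gnorm F q (V x - (\<Sum>j<n. T j x)) \<le> (\<Sum>j. a (j + n) q) * gnorm E (\<phi> q) x"
proof -
  have gF: "graded F" using F unfolding frechet_space_def by blast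
  let ?P = "\<lambda>n x. \<Sum>j<n. T j x"
  let ?t = "\<lambda>q n. \<Sum>j. a (j + n) q"
  have Pm: "?P n x \<in> gcarrier F" if "x \<in> gcarrier E" for n x
    by (intro graded_sum_mem[OF gF] Tm that)
  have le: "gnorm F q (?P m x - ?P n x) \<le> ?t q n * gnorm E (\<phi> q) x"
    if x: "x \<in> gcarrier E" and nm: "n \<le> m" for q m n x
  proof -
    have "?P m x - ?P n x = (\<Sum>j\<in>{n..<m}. T j x)"
      using sum_diff_nat_ivl[of 0 n m "\<lambda>j. T j x"] nm by (simp add: lessThan_atLeast0)
    also have "gnorm F q \<dots> \<le> (\<Sum>j\<in>{n..<m}. gnorm F q (T j x))"
      by (rule gnorm_sum_le[OF gF]) (rule Tm[OF x])
    also have "\<dots> \<le> (\<Sum>j\<in>{n..<m}. a j q * gnorm E (\<phi> q) x)" by (intro sum_mono Tb x)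
    also have "\<dots> = (\<Sum>j<m - n. a (j + n) q) * gnorm E (\<phi> q) x"
      using sum.shift_bounds_nat_ivl[of "\<lambda>j. a j q" 0 n "m - n"] nm
      by (simp add: lessThan_atLeast0 flip: sum_distrib_right)
    also have "\<dots> \<le> ?t q n * gnorm E (\<phi> q) x"
      using a by (intro mult_right_mono sum_le_suminf gnorm_nonneg[OF E x]) (auto intro: summable_ignore_initial_segment)
    finally show ?thesis .
  qed
  have t0: "(\<lambda>n. ?t q n * c) \<longlonglongrightarrow> 0" for q c
    by (intro tendsto_mult_left_zero tendsto_tail_0 a)
  have "\<exists>l. l \<in> gcarrier F \<and> (\<forall>q. (\<lambda>n. gnorm F q (?P n x - l)) \<longlonglongrightarrow> 0)" if x: "x \<in> gcarrier E" for x
  proof (rule frechet_limit_exists[OF F])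
    show "range (\<lambda>n. ?P n x) \<subseteq> gcarrier F" using Pm[OF x] by blast
    fix q and e :: real assume "e > 0"
    then obtain N where N: "\<And>n. n \<ge> N \<Longrightarrow> ?t q n * gnorm E (\<phi> q) x < e"
      using order_tendstoD(2)[OF t0, of e q "gnorm E (\<phi> q) x"] unfolding eventually_sequentially by blast
    have "gnorm F q (?P m x - ?P n x) < e" if "m \<ge> N" "n \<ge> N" for m n
    proof (cases "n \<le> m")
      case True
      then show ?thesis using le[OF x True, of q] N[OF that(2)] by linarith
    next
      case False
      then show ?thesis using le[OF x, of m n q] N[OF that(1)]
          gnorm_minus_commute[OF gF Pm[OF x] Pm[OF x], of q m n] by linarith
    qed
    then show "\<exists>N. \<forall>m\<ge>N. \<forall>n\<ge>N. gnorm F q (?P m x - ?P n x) < e" by blast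
  qed blast
  then obtain V where Vm: "\<And>x. x \<in> gcarrier E \<Longrightarrow> V x \<in> gcarrier F"
    and Vlim: "\<And>x q. x \<in> gcarrier E \<Longrightarrow> (\<lambda>n. gnorm F q (?P n x - V x)) \<longlonglongrightarrow> 0" by metis
  \<comment> \<open>The Cauchy estimate \<open>le\<close> between the partial sums \<open>m\<close>
    and \<open>n\<close>, with \<open>m\<close> tending to infinity.\<close>
  have Vb: "gnorm F q (V x - ?P n x) \<le> ?t q n * gnorm E (\<phi> q) x" if x: "x \<in> gcarrier E" for n q x
  proof -
    have "gnorm F q (V x - ?P n x) \<le> gnorm F q (?P m x - V x) + ?t q n * gnorm E (\<phi> q) x" if "m \<ge> n" for m
      using gnorm_dist_triangle[of F "V x" "?P m x" "?P n x" q, OF gF Vm[OF x] Pm[OF x] Pm[OF x]]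
        gnorm_minus_commute[of F "V x" "?P m x" q, OF gF Vm[OF x] Pm[OF x]] le[OF x that, of q] by linarith
    moreover have "(\<lambda>m. gnorm F q (?P m x - V x) + ?t q n * gnorm E (\<phi> q) x)
        \<longlonglongrightarrow> 0 + ?t q n * gnorm E (\<phi> q) x"
      by (intro tendsto_add Vlim[OF x] tendsto_const)
    ultimately have "gnorm F q (V x - ?P n x) \<le> 0 + ?t q n * gnorm E (\<phi> q) x"
      by (intro LIMSEQ_le_const) auto
    then show ?thesis by simp
  qed
  have "V (x + y) = V x + V y" if xy: "x \<in> gcarrier E" "y \<in> gcarrier E" for x y
  proof -
    note xy' = graded_add_mem[OF E xy]
    have "V (x + y) - (V x + V y) = 0"
    proof (rule frechet_eq_0[OF F])
      show "V (x + y) - (V x + V y) \<in> gcarrier F" by (intro graded_mem[OF gF] Vm xy xy')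
      fix q
      have "gnorm F q (V (x + y) - (V x + V y))
          \<le> ?t q n * gnorm E (\<phi> q) (x + y) + (?t q n * gnorm E (\<phi> q) x + ?t q n * gnorm E (\<phi> q) y)" for n
      proof -
        \<comment> \<open>The partial sums are additive, so they cancel and the defect of additivity
          consists of three remainders.\<close>
        have "V (x + y) - (V x + V y) = (V (x + y) - ?P n (x + y)) - ((V x - ?P n x) + (V y - ?P n y))"
          using Tl xy unfolding linear_map_on_def by (simp add: sum.distrib)
        also have "gnorm F q \<dots> \<le> gnorm F q (V (x + y) - ?P n (x + y))
            + (gnorm F q (V x - ?P n x) + gnorm F q (V y - ?P n y))"
          by (intro order_trans[OF gnorm_triangle_diff[OF gF]] add_left_mono gnorm_triangle[OF gF]
              graded_add_mem[OF gF] graded_diff_mem[OF gF] Vm Pm xy xy')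
        finally show ?thesis using Vb[OF xy', of q n] Vb[OF xy(1), of q n] Vb[OF xy(2), of q n] by linarith
      qed
      moreover have "(\<lambda>n. ?t q n * gnorm E (\<phi> q) (x + y) + (?t q n * gnorm E (\<phi> q) x + ?t q n * gnorm E (\<phi> q) y)) \<longlonglongrightarrow> 0 + (0 + 0)"
        by (intro tendsto_add t0)
      ultimately show "\<exists>h. h \<longlonglongrightarrow> 0 \<and> (\<forall>n. gnorm F q (V (x + y) - (V x + V y)) \<le> h n)" by auto
    qed
    then show ?thesis by simp
  qed
  moreover have "V (gscale E c x) = gscale F c (V x)" if x: "x \<in> gcarrier E" for c x
  proof -
    note cx = graded_scale_mem[OF E x, of c]
    have "V (gscale E c x) - gscale F c (V x) = 0"
    proof (rule frechet_eq_0[OF F])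
      show "V (gscale E c x) - gscale F c (V x) \<in> gcarrier F" by (intro graded_mem[OF gF] Vm x cx)
      fix q
      have "gnorm F q (V (gscale E c x) - gscale F c (V x))
          \<le> ?t q n * gnorm E (\<phi> q) (gscale E c x) + norm c * (?t q n * gnorm E (\<phi> q) x)" for n
      proof -
        have "?P n (gscale E c x) = gscale F c (?P n x)"
          using Tl x unfolding linear_map_on_def by (simp add: module.scale_sum_right[OF graded_module[OF gF]])
        then have "V (gscale E c x) - gscale F c (V x)
            = (V (gscale E c x) - ?P n (gscale E c x)) - gscale F c (V x - ?P n x)"
          by (simp add: module.scale_right_diff_distrib[OF graded_module[OF gF]])
        also have "gnorm F q \<dots> \<le> gnorm F q (V (gscale E c x) - ?P n (gscale E c x))
            + gnorm F q (gscale F c (V x - ?P n x))"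
          by (intro gnorm_triangle_diff[OF gF] graded_scale_mem[OF gF] graded_diff_mem[OF gF] Vm Pm x cx)
        also have "gnorm F q (gscale F c (V x - ?P n x)) = norm c * gnorm F q (V x - ?P n x)"
          by (intro gnorm_scale[OF gF] graded_diff_mem[OF gF] Vm Pm x)
        finally show ?thesis
          using Vb[OF cx, of q n] mult_left_mono[OF Vb[OF x, of q n] norm_ge_zero[of c]] by linarith
      qed
      moreover have "(\<lambda>n. ?t q n * gnorm E (\<phi> q) (gscale E c x) + norm c * (?t q n * gnorm E (\<phi> q) x)) \<longlonglongrightarrow> 0 + norm c * 0"
        by (intro tendsto_add tendsto_mult_left t0)
      ultimately show "\<exists>h. h \<longlonglongrightarrow> 0 \<and> (\<forall>n. gnorm F q (V (gscale E c x) - gscale F c (V x)) \<le> h n)" by auto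
    qed
    then show ?thesis by simp
  qed
  ultimately have "linear_map_on (gcarrier E) (gscale E) (gscale F) V" unfolding linear_map_on_def by blast
  moreover have "\<exists>r c. \<forall>x\<in>gcarrier E. gnorm F q (V x) \<le> c * gnorm E r x" for q
    using Vb[of _ q 0] by auto
  ultimately have "V \<in> operators E F" using Vm by (intro operatorsI[OF E gF]) auto
  then show thesis using that Vb by blast
qed

text \<open>The bit sequence \<open>w\<close> selects the summands. All estimates are uniform in
  \<open>w\<close>, so \<open>V w\<close> depends continuously on \<open>w\<close>: agreement below
  \<open>n\<close> leaves an error of one tail for each of the two operators. Flipping a single bit
  isolates a single summand.\<close>

lemma masked_operator_series:
  fixes T :: "nat \<Rightarrow> 'e::ab_group_add \<Rightarrow> 'f::ab_group_add"
    and E :: "('k::real_normed_field, 'e) graded_space" and F :: "('k, 'f) graded_space"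
  assumes E: "graded E" and F: "frechet_space F"
    and Tm: "\<And>j x. x \<in> gcarrier E \<Longrightarrow> T j x \<in> gcarrier F"
    and Tl: "\<And>j. linear_map_on (gcarrier E) (gscale E) (gscale F) (T j)"
    and Tb: "\<And>j q x. x \<in> gcarrier E \<Longrightarrow> gnorm F q (T j x) \<le> a j q * gnorm E (\<phi> q) x"
    and a: "\<And>j q. 0 \<le> a j q" "\<And>q. summable (\<lambda>j. a j q)"
  obtains V where "\<And>w :: nat \<Rightarrow> bool. V w \<in> operators E F"
    "\<And>w q x. x \<in> gcarrier E \<Longrightarrow> gnorm F q (V w x) \<le> (\<Sum>j. a j q) * gnorm E (\<phi> q) x"
    "\<And>w w' n q x. \<lbrakk>\<forall>j<n. w j = w' j; x \<in> gcarrier E\<rbrakk> \<Longrightarrow>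
      gnorm F q (V w x - V w' x) \<le> 2 * (\<Sum>j. a (j + n) q) * gnorm E (\<phi> q) x"
    "\<And>w j x. x \<in> gcarrier E \<Longrightarrow> V (w(j := True)) x - V (w(j := False)) x = T j x"
proof -
  have gF: "graded F" using F unfolding frechet_space_def by blast
  let ?T = "\<lambda>w j x. if w j then T j x else 0"
  let ?P = "\<lambda>w n x. \<Sum>j<n. ?T w j x"
  let ?t = "\<lambda>q n. \<Sum>j. a (j + n) q"
  have ex: "\<exists>V. V \<in> operators E F \<and> (\<forall>n q. \<forall>x\<in>gcarrier E.
      gnorm F q (V x - ?P w n x) \<le> ?t q n * gnorm E (\<phi> q) x)" for w :: "nat \<Rightarrow> bool"
  proof -
    have 1: "?T w j x \<in> gcarrier F" if "x \<in> gcarrier E" for j x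
      using that by (simp add: Tm graded_zero_mem[OF gF])
    have 2: "linear_map_on (gcarrier E) (gscale E) (gscale F) (?T w j)" for j
      using Tl unfolding linear_map_on_def by (simp add: module.scale_zero_right[OF graded_module[OF gF]])
    have 3: "gnorm F q (?T w j x) \<le> a j q * gnorm E (\<phi> q) x" if "x \<in> gcarrier E" for j q x
      using Tb[OF that] a(1) gnorm_nonneg[OF E that] by (simp add: gnorm_zero[OF gF])
    obtain V where "V \<in> operators E F" "\<And>n q x. x \<in> gcarrier E \<Longrightarrow>
        gnorm F q (V x - ?P w n x) \<le> ?t q n * gnorm E (\<phi> q) x"
      by (rule operator_series[OF E F 1 2 3 a]) (assumption | (erule that, blast))+
    then show ?thesis by blast
  qed
  have "\<forall>w. \<exists>V. V \<in> operators E F \<and> (\<forall>n q. \<forall>x\<in>gcarrier E.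
      gnorm F q (V x - ?P w n x) \<le> ?t q n * gnorm E (\<phi> q) x)"
    by (rule allI) (rule ex)
  then have "\<exists>V. \<forall>w. V w \<in> operators E F \<and> (\<forall>n q. \<forall>x\<in>gcarrier E.
      gnorm F q (V w x - ?P w n x) \<le> ?t q n * gnorm E (\<phi> q) x)"
    by (rule choice)
  then obtain V where V: "\<forall>w. V w \<in> operators E F \<and> (\<forall>n q. \<forall>x\<in>gcarrier E.
      gnorm F q (V w x - ?P w n x) \<le> ?t q n * gnorm E (\<phi> q) x)"
    by (rule exE)
  then have Vop: "V w \<in> operators E F" for w by simp
  from V have Vb: "gnorm F q (V w x - ?P w n x) \<le> ?t q n * gnorm E (\<phi> q) x"
    if "x \<in> gcarrier E" for w n q x using that by simp
  have Vm: "V w x \<in> gcarrier F" if "x \<in> gcarrier E" for w x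
    using Vop[of w] that unfolding operators_def by blast
  have Pm: "?P w n x \<in> gcarrier F" if "x \<in> gcarrier E" for w n x
    using that by (intro graded_sum_mem[OF gF]) (simp add: Tm graded_zero_mem[OF gF])
  show thesis
  proof (rule that[of V])
    show "V w \<in> operators E F" for w by (rule Vop)
    show "gnorm F q (V w x) \<le> (\<Sum>j. a j q) * gnorm E (\<phi> q) x" if "x \<in> gcarrier E" for w q x
      using Vb[OF that, of q w 0] by simp
    have diff: "gnorm F q ((V w x - V w' x) - (?P w n x - ?P w' n x)) \<le> 2 * ?t q n * gnorm E (\<phi> q) x"
      if x: "x \<in> gcarrier E" for w w' n q x
    proof -
      have "(V w x - V w' x) - (?P w n x - ?P w' n x) = (V w x - ?P w n x) - (V w' x - ?P w' n x)"
        by simp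
      also have "gnorm F q \<dots> \<le> gnorm F q (V w x - ?P w n x) + gnorm F q (V w' x - ?P w' n x)"
        by (intro gnorm_triangle_diff[OF gF] graded_diff_mem[OF gF] Vm[OF x] Pm[OF x])
      finally show ?thesis using Vb[OF x, of q w n] Vb[OF x, of q w' n] by linarith
    qed
    show "gnorm F q (V w x - V w' x) \<le> 2 * ?t q n * gnorm E (\<phi> q) x"
      if "\<forall>j<n. w j = w' j" and x: "x \<in> gcarrier E" for w w' n q x
    proof -
      have "?P w n x = ?P w' n x" using that(1) by (intro sum.cong) auto
      then show ?thesis using diff[OF x, of q w w' n] by simp
    qed
    show "V (w(j := True)) x - V (w(j := False)) x = T j x" if x: "x \<in> gcarrier E" for w j x
    proof -
      let ?w1 = "w(j := True)" and ?w0 = "w(j := False)"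
      have "V ?w1 x - V ?w0 x - T j x = 0"
      proof (rule frechet_eq_0[OF F])
        show "V ?w1 x - V ?w0 x - T j x \<in> gcarrier F"
          by (intro graded_diff_mem[OF gF] Vm[OF x] Tm[OF x])
        fix q
        \<comment> \<open>Partial sums of length at least \<open>Suc j\<close> contain the switched
          summand, so their difference is exact and only the tails of the two series remain.\<close>
        have "?P ?w1 (Suc j + n) x - ?P ?w0 (Suc j + n) x = T j x" for n
        proof -
          have "?P ?w1 (Suc j + n) x - ?P ?w0 (Suc j + n) x
              = (\<Sum>i<Suc j + n. ?T ?w1 i x - ?T ?w0 i x)"
            by (simp only: sum_subtractf)
          also have "\<dots> = (\<Sum>i<Suc j + n. if i = j then T j x else 0)" by (intro sum.cong) auto
          finally show ?thesis by simp
        qed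
        then have "gnorm F q (V ?w1 x - V ?w0 x - T j x) \<le> 2 * ?t q (n + Suc j) * gnorm E (\<phi> q) x" for n
          using diff[OF x, of q ?w1 ?w0 "Suc j + n"] by (simp only: add.commute)
        moreover have "(\<lambda>n. 2 * ?t q (n + Suc j) * gnorm E (\<phi> q) x) \<longlonglongrightarrow> 0"
        proof -
          have "(\<lambda>n. ?t q (n + Suc j)) \<longlonglongrightarrow> 0"
            using LIMSEQ_ignore_initial_segment[OF tendsto_tail_0[OF a(2)[of q]], of "Suc j"] .
          from tendsto_mult_right[OF tendsto_mult_left[OF this, of 2], of "gnorm E (\<phi> q) x"]
          show ?thesis by simp
        qed
        ultimately show "\<exists>h. h \<longlonglongrightarrow> 0 \<and> (\<forall>n. gnorm F q (V ?w1 x - V ?w0 x - T j x) \<le> h n)" by blast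
      qed
      then show ?thesis by simp
    qed
  qed
qed

text \<open>Baire's theorem for a countable power of a discrete space: \<open>closed\<close> is
  closedness in the product topology, and the conclusion is that some member of the cover contains a
  cylinder. Otherwise there are nested cylinders of growing length whose successive members avoid
  each \<open>A m\<close> in turn, and their common point lies in no \<open>A m\<close>.\<close>

lemma sequences_Baire:
  fixes A :: "nat \<Rightarrow> (nat \<Rightarrow> 'a) set"
  assumes closed: "\<And>m w. (\<And>n. \<exists>v\<in>A m. \<forall>j<n. v j = w j) \<Longrightarrow> w \<in> A m"
    and cover: "\<And>w. \<exists>m. w \<in> A m"
  obtains m v n where "\<And>w. (\<And>j. j < n \<Longrightarrow> w j = v j) \<Longrightarrow> w \<in> A m"
proof -
  have "\<exists>m v n. \<forall>w. (\<forall>j<n. w j = v j) \<longrightarrow> w \<in> A m"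
  proof (rule ccontr)
    assume neg: "\<not> ?thesis"
    \<comment> \<open>A pair \<open>p\<close> encodes the cylinder of all sequences that agree with
      \<open>fst p\<close> below \<open>snd p\<close>.\<close>
    have step: "\<exists>p'. (\<forall>j<snd p. fst p' j = fst p j) \<and> snd p < snd p' \<and>
        (\<forall>v. (\<forall>j<snd p'. v j = fst p' j) \<longrightarrow> v \<notin> A m)" for p :: "(nat \<Rightarrow> 'a) \<times> nat" and m
    proof -
      obtain w where w: "\<forall>j<snd p. w j = fst p j" "w \<notin> A m" using neg by blast
      obtain n where n: "\<forall>v\<in>A m. \<exists>j<n. v j \<noteq> w j" using closed[of m w] w(2) by blast
      \<comment> \<open>The maximum with \<open>Suc (snd p)\<close> makes the lengths strictly
        increasing, so that in the end every coordinate gets fixed.\<close>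
      have "v \<notin> A m" if "\<forall>j<max n (Suc (snd p)). v j = w j" for v
        using n that by (meson less_max_iff_disj)
      then show ?thesis using w(1) by (intro exI[of _ "(w, max n (Suc (snd p)))"]) auto
    qed
    have "\<exists>f. \<forall>m. True \<and> ((\<forall>j<snd (f m). fst (f (Suc m)) j = fst (f m) j) \<and> snd (f m) < snd (f (Suc m)) \<and>
        (\<forall>v. (\<forall>j<snd (f (Suc m)). v j = fst (f (Suc m)) j) \<longrightarrow> v \<notin> A m))"
      by (rule dependent_nat_choice[where P = "\<lambda>_ _. True" and
          Q = "\<lambda>m p p'. (\<forall>j<snd p. fst p' j = fst p j) \<and> snd p < snd p' \<and>
            (\<forall>v. (\<forall>j<snd p'. v j = fst p' j) \<longrightarrow> v \<notin> A m)"]) (simp_all add: step del: split_paired_Ex)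
    then obtain f where f: "\<And>m j. j < snd (f m) \<Longrightarrow> fst (f (Suc m)) j = fst (f m) j"
      "\<And>m. snd (f m) < snd (f (Suc m))"
      "\<And>m v. (\<forall>j<snd (f (Suc m)). v j = fst (f (Suc m)) j) \<Longrightarrow> v \<notin> A m" by blast
    have mono: "snd (f m) \<le> snd (f n)" if "m \<le> n" for m n
      using lift_Suc_mono_le[of "\<lambda>m. snd (f m)", OF less_imp_le[OF f(2)] that] .
    have ge: "m \<le> snd (f m)" for m
      by (induction m) (use f(2) Suc_leI order.strict_trans1 in blast)+
    have stable: "fst (f n) j = fst (f m) j" if "m \<le> n" "j < snd (f m)" for m n j
      using that(1)
    proof (induction n rule: dec_induct)
      case (step n)
      then show ?case using f(1)[of j n] mono[of m n] that(2) by simp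
    qed simp
    \<comment> \<open>Coordinate \<open>j\<close> is read off at stage \<open>Suc j\<close>, where
      by \<open>ge\<close> the cylinder is longer than \<open>j\<close> and the entry no longer
      changes.\<close>
    define v where "v j = fst (f (Suc j)) j" for j
    have "v j = fst (f m) j" if "j < snd (f m)" for m j
    proof (cases "m \<le> Suc j")
      case True
      then show ?thesis using stable[OF True that] unfolding v_def by simp
    next
      case False
      then have "Suc j \<le> m" by simp
      moreover have "j < snd (f (Suc j))" using ge[of "Suc j"] by simp
      ultimately show ?thesis using stable[of "Suc j" m j] unfolding v_def by simp
    qed
    then have "v \<notin> A m" for m using f(3) by blast
    then show False using cover by blast
  qed
  then show thesis using that by blast
qed

section \<open>From tame factorization to the estimate\<close>

text \<open>Normalizes a counterexample: both factors get norm at most \<open>1\<close> at all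
  grades up to \<open>n\<close>, and the failure becomes a value above \<open>C\<close> at a single
  vector \<open>x\<close>. The condition \<open>\<phi> k \<le> n\<close> forces
  \<open>b i n > 0\<close>, which gives both factors finite norms at the grades beyond
  \<open>n\<close> too, so that they are continuous operators.\<close>

lemma rank_one_violation:
  fixes E :: "('k::real_normed_field, 'e::ab_group_add) graded_space"
    and F :: "('k, 'f::ab_group_add) graded_space"
  assumes E: "graded E" and F: "graded F" and b: "koethe_matrix b" and phi: "mono \<phi>"
    and viol: "\<not> rank_one_estimate E F b \<phi> s k n C" and C: "0 < C" and n: "k \<le> n" "\<phi> k \<le> n"
  obtains u z i x where "u \<in> dual E" "z \<in> gcarrier F" "x \<in> gcarrier E" "gnorm E s x \<le> 1"
    "C < norm (u x) * gnorm F k z"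
    "\<And>q y. q \<le> n \<Longrightarrow> y \<in> gcarrier E \<Longrightarrow> norm (u y) * b i q \<le> gnorm E (\<phi> q) y"
    "\<And>q. \<exists>c\<ge>0. \<forall>y\<in>gcarrier E. norm (u y) * b i q \<le> c * gnorm E (\<phi> q) y"
    "\<And>q. q \<le> n \<Longrightarrow> gnorm F q z \<le> b i (\<phi> q)"
    "\<And>q. \<exists>c\<ge>0. gnorm F q z \<le> c * b i (\<phi> q)"
proof -
  note b0 = koethe_matrix_nonneg[OF b]
  obtain u0 z0 i where u0: "u0 \<in> dual E" and z0: "z0 \<in> gcarrier F"
    and lt: "ennreal C * max_prod (MAX q\<in>{..n}. dual_norm E (\<phi> q) u0 * ennreal (b i q))
          (MAX q\<in>{..n}. ennreal (gnorm F q z0) / ennreal (b i (\<phi> q)))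
        < dual_norm E s u0 * ennreal (gnorm F k z0)"
    using viol unfolding rank_one_estimate_def not_le[symmetric] by blast
  define A where "A = (MAX q\<in>{..n}. dual_norm E (\<phi> q) u0 * ennreal (b i q))"
  define B where "B = (MAX q\<in>{..n}. ennreal (gnorm F q z0) / ennreal (b i (\<phi> q)))"
  \<comment> \<open>The right side of the estimate lies strictly below another value and
    \<open>C\<close> is positive, so the product of the maxima is finite; by the convention for such
    products, each maximum is finite.\<close>
  have "max_prod A B \<noteq> \<infinity>"
    using lt C unfolding A_def[symmetric] B_def[symmetric] by (auto simp: ennreal_mult_top)
  then have AB: "A < \<infinity>" "B < \<infinity>" "max_prod A B = A * B"
    unfolding max_prod_def by (auto simp: top.not_eq_extremum split: if_splits)
  define \<alpha> where "\<alpha> = enn2real A"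
  define \<beta> where "\<beta> = enn2real B"
  have \<alpha>: "A = ennreal \<alpha>" "0 \<le> \<alpha>" and \<beta>: "B = ennreal \<beta>" "0 \<le> \<beta>"
    using AB unfolding \<alpha>_def \<beta>_def by simp_all
  have z0n: "0 \<le> gnorm F q z0" for q by (rule gnorm_nonneg[OF F z0])
  have A_le: "dual_norm E (\<phi> q) u0 * ennreal (b i q) \<le> ennreal \<alpha>" if "q \<le> n" for q
    unfolding \<alpha>(1)[symmetric] A_def using that by (intro Max_ge) auto
  have B_le: "ennreal (gnorm F q z0) / ennreal (b i (\<phi> q)) \<le> ennreal \<beta>" if "q \<le> n" for q
    unfolding \<beta>(1)[symmetric] B_def using that by (intro Max_ge) auto
  \<comment> \<open>Where the denominator is zero, a finite quotient forces a zero
    numerator.\<close>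
  have z_le: "gnorm F q z0 \<le> \<beta> * b i (\<phi> q)" if q: "q \<le> n" for q
  proof (cases "b i (\<phi> q) = 0")
    case True
    then have "gnorm F q z0 \<le> 0"
      using B_le[OF q] by (cases "gnorm F q z0 \<le> 0") (simp_all add: divide_ennreal_def ennreal_mult_top top_unique)
    then show ?thesis using True by simp
  next
    case False
    then have "b i (\<phi> q) > 0" using b0[of i "\<phi> q"] by simp
    then show ?thesis using B_le[OF q] z0n \<beta>(2) by (simp add: divide_ennreal field_simps)
  qed
  \<comment> \<open>The left side of the estimate is positive, so \<open>z0\<close> is nonzero at
    grade \<open>k\<close>. Hence \<open>b i (\<phi> k)\<close> is nonzero and row \<open>i\<close>
    is positive from column \<open>\<phi> k\<close> on.\<close>
  have zk: "gnorm F k z0 > 0" using lt z0n[of k] by (cases "gnorm F k z0 = 0") auto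
  then have "b i (\<phi> k) \<noteq> 0" using z_le[OF n(1)] by auto
  then have bpos: "0 < b i q" if "\<phi> k \<le> q" for q
    using koethe_matrix_mono[OF b that, of i] b0[of i "\<phi> k"] by simp
  have u_le: "norm (u0 y) * b i q \<le> \<alpha> * gnorm E (\<phi> q) y" if q: "q \<le> n" and y: "y \<in> gcarrier E" for q y
  proof (cases "b i q = 0")
    case True
    then show ?thesis using \<alpha>(2) gnorm_nonneg[OF E y] by simp
  next
    case False
    then have bq: "b i q > 0" using b0[of i q] by simp
    then have c: "0 \<le> \<alpha> / b i q" using \<alpha>(2) by simp
    have "dual_norm E (\<phi> q) u0 = dual_norm E (\<phi> q) u0 * ennreal (b i q) * ennreal (1 / b i q)"
      using bq by (simp add: mult.assoc flip: ennreal_mult)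
    also have "\<dots> \<le> ennreal \<alpha> * ennreal (1 / b i q)" by (rule mult_right_mono[OF A_le[OF q]]) simp
    also have "\<dots> = ennreal (\<alpha> / b i q)" using bq \<alpha>(2) by (simp flip: ennreal_mult)
    finally have "norm (u0 y) \<le> \<alpha> / b i q * gnorm E (\<phi> q) y"
      using dual_norm_le_iff[OF E u0 c] y by blast
    then show ?thesis using bq by (simp add: field_simps)
  qed
  have u_all: "\<exists>c\<ge>0. \<forall>y\<in>gcarrier E. norm (u0 y) * b i q \<le> c * gnorm E (\<phi> q) y" for q
  proof (cases "q \<le> n")
    case True
    then show ?thesis using u_le \<alpha>(2) by blast
  next
    case False
    then have nq: "n \<le> q" by simp
    have bn: "b i n > 0" by (rule bpos[OF n(2)])
    have "norm (u0 y) * b i q \<le> \<alpha> / b i n * b i q * gnorm E (\<phi> q) y" if y: "y \<in> gcarrier E" for y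
    proof -
      have "norm (u0 y) * b i n \<le> \<alpha> * gnorm E (\<phi> q) y"
        using u_le[OF order_refl y] mult_left_mono[OF gnorm_mono[OF E y monoD[OF phi nq]] \<alpha>(2)] by linarith
      then have "norm (u0 y) \<le> \<alpha> / b i n * gnorm E (\<phi> q) y" using bn by (simp add: field_simps)
      from mult_right_mono[OF this b0[of i q]] show ?thesis by (simp add: mult_ac)
    qed
    moreover have "0 \<le> \<alpha> / b i n * b i q" using \<alpha>(2) b0 by simp
    ultimately show ?thesis by blast
  qed
  have z_all: "\<exists>c\<ge>0. gnorm F q z0 \<le> c * b i (\<phi> q)" for q
  proof (cases "q \<le> n")
    case True
    then show ?thesis using z_le \<beta>(2) by blast
  next
    case False
    then have "b i (\<phi> q) > 0" using n(1) by (intro bpos monoD[OF phi]) simp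
    then show ?thesis using z0n by (intro exI[of _ "gnorm F q z0 / b i (\<phi> q)"]) simp
  qed
  have "ennreal C * (A * B) < dual_norm E s u0 * ennreal (gnorm F k z0)"
    using lt unfolding A_def[symmetric] B_def[symmetric] AB(3) .
  \<comment> \<open>With the factor moved inside the supremum, the strict inequality is witnessed by
    one vector of the unit ball, even if the dual norm is infinite.\<close>
  then have "ennreal C * (A * B) < (SUP x\<in>{x \<in> gcarrier E. gnorm E s x \<le> 1}. ennreal (norm (u0 x)) * ennreal (gnorm F k z0))"
    unfolding dual_norm_def SUP_mult_right_ennreal .
  then obtain x where x: "x \<in> gcarrier E" "gnorm E s x \<le> 1"
    and xl: "ennreal C * (A * B) < ennreal (norm (u0 x)) * ennreal (gnorm F k z0)"
    unfolding less_SUP_iff by blast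
  have "C * (\<alpha> * \<beta>) < norm (u0 x) * gnorm F k z0"
    using xl C \<alpha> \<beta> z0n[of k] by (simp add: ennreal_less_iff flip: ennreal_mult)
  \<comment> \<open>The maxima may vanish, so they are enlarged slightly before being divided out.\<close>
  moreover have "((\<lambda>e. C * ((\<alpha> + e) * (\<beta> + e))) \<longlongrightarrow> C * ((\<alpha> + 0) * (\<beta> + 0))) (at_right 0)"
    by (intro tendsto_intros)
  ultimately have "\<forall>\<^sub>F e in at_right 0. C * ((\<alpha> + e) * (\<beta> + e)) < norm (u0 x) * gnorm F k z0"
    by (intro order_tendstoD(2)) auto
  then have "\<exists>e. 0 < e \<and> C * ((\<alpha> + e) * (\<beta> + e)) < norm (u0 x) * gnorm F k z0"
    by (intro eventually_happens'[OF trivial_limit_at_right_real] eventually_conj)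
      (rule eventually_at_right_less)
  then obtain e where e: "e > 0" "C * ((\<alpha> + e) * (\<beta> + e)) < norm (u0 x) * gnorm F k z0" by blast
  define a where "a = 1 / (\<alpha> + e)"
  define d where "d = 1 / (\<beta> + e)"
  have a: "0 < a" "a * \<alpha> \<le> 1" and d: "0 < d" "d * \<beta> \<le> 1"
    using e(1) \<alpha>(2) \<beta>(2) unfolding a_def d_def by (auto simp: field_simps)
  show thesis
  proof (rule that[of "\<lambda>y. of_real a * u0 y" "gscale F (of_real d) z0" x i])
    obtain r c where rc: "0 \<le> c" "\<And>y. y \<in> gcarrier E \<Longrightarrow> norm (u0 y) \<le> c * gnorm E r y"
      by (rule dual_bounded[OF E u0]) (erule that, blast)
    show "(\<lambda>y. of_real a * u0 y) \<in> dual E"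
    proof (rule dualI[OF E])
      show "linear_map_on (gcarrier E) (gscale E) (*) (\<lambda>y. of_real a * u0 y)"
        using u0 unfolding dual_def linear_map_on_def by (simp add: distrib_left mult.left_commute)
      show "norm (of_real a * u0 y) \<le> a * c * gnorm E r y" if "y \<in> gcarrier E" for y
        using mult_left_mono[OF rc(2)[OF that] less_imp_le[OF a(1)]] a(1) by (simp add: norm_mult mult.assoc)
    qed
    show "gscale F (of_real d) z0 \<in> gcarrier F" by (rule graded_scale_mem[OF F z0])
    show "x \<in> gcarrier E" "gnorm E s x \<le> 1" by (fact x)+
    have "\<alpha> + e \<noteq> 0" "\<beta> + e \<noteq> 0" using e(1) \<alpha>(2) \<beta>(2) by auto
    then have "C = a * d * (C * ((\<alpha> + e) * (\<beta> + e)))" unfolding a_def d_def by simp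
    also have "\<dots> < a * d * (norm (u0 x) * gnorm F k z0)"
      using e(2) a(1) d(1) by (intro mult_strict_left_mono) simp_all
    finally show "C < norm (of_real a * u0 x) * gnorm F k (gscale F (of_real d) z0)"
      using a(1) d(1) by (simp add: norm_mult gnorm_scale[OF F z0] mult_ac)
    show "norm (of_real a * u0 y) * b i q \<le> gnorm E (\<phi> q) y" if "q \<le> n" "y \<in> gcarrier E" for q y
    proof -
      have "a * (norm (u0 y) * b i q) \<le> a * (\<alpha> * gnorm E (\<phi> q) y)"
        using u_le[OF that] a(1) by (intro mult_left_mono) auto
      also have "\<dots> \<le> 1 * gnorm E (\<phi> q) y"
        unfolding mult.assoc[symmetric] by (intro mult_right_mono a gnorm_nonneg[OF E that(2)])
      finally show ?thesis using a(1) by (simp add: norm_mult mult.assoc)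
    qed
    show "\<exists>c\<ge>0. \<forall>y\<in>gcarrier E. norm (of_real a * u0 y) * b i q \<le> c * gnorm E (\<phi> q) y" for q
    proof -
      obtain c where c: "c \<ge> 0" "\<And>y. y \<in> gcarrier E \<Longrightarrow> norm (u0 y) * b i q \<le> c * gnorm E (\<phi> q) y"
        using u_all[of q] by blast
      have "norm (of_real a * u0 y) * b i q \<le> a * c * gnorm E (\<phi> q) y" if "y \<in> gcarrier E" for y
        using mult_left_mono[OF c(2)[OF that] less_imp_le[OF a(1)]] a(1) by (simp add: norm_mult mult.assoc)
      moreover have "0 \<le> a * c" using a(1) c(1) by simp
      ultimately show ?thesis by blast
    qed
    show "gnorm F q (gscale F (of_real d) z0) \<le> b i (\<phi> q)" if "q \<le> n" for q
    proof -
      have "d * gnorm F q z0 \<le> d * (\<beta> * b i (\<phi> q))"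
        using z_le[OF that] d(1) by (intro mult_left_mono) auto
      also have "\<dots> \<le> 1 * b i (\<phi> q)"
        unfolding mult.assoc[symmetric] by (intro mult_right_mono d b0)
      finally show ?thesis using d(1) by (simp add: gnorm_scale[OF F z0])
    qed
    show "\<exists>c\<ge>0. gnorm F q (gscale F (of_real d) z0) \<le> c * b i (\<phi> q)" for q
    proof -
      obtain c where c: "c \<ge> 0" "gnorm F q z0 \<le> c * b i (\<phi> q)" using z_all[of q] by blast
      have "gnorm F q (gscale F (of_real d) z0) \<le> d * c * b i (\<phi> q)"
        using mult_left_mono[OF c(2) less_imp_le[OF d(1)]] d(1) by (simp add: gnorm_scale[OF F z0] mult.assoc)
      moreover have "0 \<le> d * c" using d(1) c(1) by simp
      ultimately show ?thesis by blast
    qed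
  qed
qed

text \<open>For fixed \<open>q\<close> only the finitely many \<open>j < q\<close> carry the
  uncontrolled constants \<open>c j\<close>; from \<open>q\<close> on the series is
  geometric.\<close>

lemma summable_dyadic_weights:
  "summable (\<lambda>j. (1 / 2) ^ j * (if q \<le> j then 1 else c j :: real))"
proof -
  have "\<forall>\<^sub>F j in sequentially. (1 / 2) ^ j * (if q \<le> j then 1 else c j) = ((1 / 2) ^ j :: real)"
    using eventually_ge_at_top[of q] by eventually_elim simp
  from summable_cong[OF this] show ?thesis using summable_geometric[of "1 / 2 :: real"] by simp
qed

lemma factoring_operators_comp:
  assumes "Q \<in> operators E G" "R \<in> operators G F"
  shows "(\<lambda>x. R (Q x)) \<in> factoring_operators E G F"
proof -
  have "continuous_map (gtopology E) (gtopology F) (R \<circ> Q)"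
    using assms unfolding operators_def by (auto intro: continuous_map_compose)
  moreover have "linear_map_on (gcarrier E) (gscale E) (gscale F) (\<lambda>x. R (Q x))"
    using assms unfolding operators_def linear_map_on_def by (auto simp: image_subset_iff)
  ultimately have "(\<lambda>x. R (Q x)) \<in> operators E F"
    using assms unfolding operators_def by (auto simp: comp_def image_subset_iff)
  then show ?thesis using assms unfolding factoring_operators_def by blast
qed

lemma estimate_of_tame_factorization:
  fixes E :: "('k::{real_normed_field, banach}, 'e::ab_group_add) graded_space"
    and F :: "('k, 'f::ab_group_add) graded_space"
  assumes E: "graded E" and F: "frechet_space F" and b: "koethe_matrix b" and phi: "mono \<phi>"
    and tame: "\<And>T. T \<in> factoring_operators E (koethe_space b) F \<Longrightarrow>
      \<exists>k0. \<forall>k\<ge>k0. char_of_continuity E F T k \<le> enat (S k)"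
  shows "\<exists>k0. \<forall>k\<ge>k0. \<exists>q C. C > 0 \<and> rank_one_estimate E F b \<phi> (S k) k q C"
proof (rule ccontr)
  assume "\<not> ?thesis"
  then have "\<forall>k0. \<exists>k\<ge>k0. \<forall>q C. C > 0 \<longrightarrow> \<not> rank_one_estimate E F b \<phi> (S k) k q C" by simp
  then obtain \<beta> where \<beta>: "\<And>m. m \<le> \<beta> m"
    "\<And>m q C. C > 0 \<Longrightarrow> \<not> rank_one_estimate E F b \<phi> (S (\<beta> m)) (\<beta> m) q C" by metis
  let ?K = "koethe_space b :: ('k, nat \<Rightarrow> 'k) graded_space"
  note b0 = koethe_matrix_nonneg[OF b] and gr = graded_koethe[OF b, where 'k = 'k]
    and FK = frechet_koethe[OF b, where 'k = 'k]
  have gF: "graded F" using F unfolding frechet_space_def by blast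
  \<comment> \<open>\<open>\<kappa>\<close> takes every value of \<open>\<beta>\<close> infinitely often.\<close>
  define \<kappa> where "\<kappa> j = \<beta> (fst (prod_decode j))" for j
  \<comment> \<open>The dyadic weights of the two factors together cost \<open>(1 / 4) ^ j\<close>,
    so a violation by \<open>16 ^ j\<close> still leaves \<open>4 ^ j\<close>, which outgrows every
    constant.\<close>
  define P where "P j u z i x \<longleftrightarrow> u \<in> dual E \<and> z \<in> gcarrier F \<and> x \<in> gcarrier E \<and> gnorm E (S (\<kappa> j)) x \<le> 1 \<and>
      16 ^ j < norm (u x) * gnorm F (\<kappa> j) z \<and>
      (\<forall>q\<le>j. \<forall>y\<in>gcarrier E. norm (u y) * b i q \<le> gnorm E (\<phi> q) y) \<and>
      (\<forall>q. \<exists>c\<ge>0. \<forall>y\<in>gcarrier E. norm (u y) * b i q \<le> c * gnorm E (\<phi> q) y) \<and>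
      (\<forall>q\<le>j. gnorm F q z \<le> b i (\<phi> q)) \<and>
      (\<forall>q. \<exists>c\<ge>0. gnorm F q z \<le> c * b i (\<phi> q))" for j u z i x
  have "\<exists>p. P j (fst p) (fst (snd p)) (fst (snd (snd p))) (snd (snd (snd p)))" for j
  proof -
    \<comment> \<open>The entry \<open>j\<close> gives the unit bounds at all grades up to
      \<open>j\<close>; the other two entries are the thresholds that
      \<open>rank_one_violation\<close> asks for.\<close>
    let ?n = "max j (max (\<kappa> j) (\<phi> (\<kappa> j)))"
    have C: "(0 :: real) < 16 ^ j" by simp
    have nv: "\<not> rank_one_estimate E F b \<phi> (S (\<kappa> j)) (\<kappa> j) ?n (16 ^ j)"
      unfolding \<kappa>_def by (rule \<beta>(2)[OF C])
    have n: "\<kappa> j \<le> ?n" "\<phi> (\<kappa> j) \<le> ?n" by simp_all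
    obtain u z i x where "u \<in> dual E" "z \<in> gcarrier F" "x \<in> gcarrier E" "gnorm E (S (\<kappa> j)) x \<le> 1"
      "16 ^ j < norm (u x) * gnorm F (\<kappa> j) z"
      "\<And>q y. q \<le> ?n \<Longrightarrow> y \<in> gcarrier E \<Longrightarrow> norm (u y) * b i q \<le> gnorm E (\<phi> q) y"
      "\<And>q. \<exists>c\<ge>0. \<forall>y\<in>gcarrier E. norm (u y) * b i q \<le> c * gnorm E (\<phi> q) y"
      "\<And>q. q \<le> ?n \<Longrightarrow> gnorm F q z \<le> b i (\<phi> q)"
      "\<And>q. \<exists>c\<ge>0. gnorm F q z \<le> c * b i (\<phi> q)"
      by (rule rank_one_violation[OF E gF b phi nv C n]) (erule (4) that, blast+)
    then have "P j u z i x" unfolding P_def by simp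
    then show ?thesis by (intro exI[of _ "(u, z, i, x)"]) simp
  qed
  then obtain f where f: "\<And>j. P j (fst (f j)) (fst (snd (f j))) (fst (snd (snd (f j)))) (snd (snd (snd (f j))))"
    by metis
  define u where "u j = fst (f j)" for j
  define z where "z j = fst (snd (f j))" for j
  define i where "i j = fst (snd (snd (f j)))" for j
  define x where "x j = snd (snd (snd (f j)))" for j
  have Pj: "P j (u j) (z j) (i j) (x j)" for j using f unfolding u_def z_def i_def x_def .
  have u: "linear_map_on (gcarrier E) (gscale E) (*) (u j)" for j
    using Pj[of j] unfolding P_def dual_def by blast
  have z: "z j \<in> gcarrier F" for j using Pj[of j] unfolding P_def by blast
  have x: "x j \<in> gcarrier E" "gnorm E (S (\<kappa> j)) (x j) \<le> 1" "16 ^ j < norm (u j (x j)) * gnorm F (\<kappa> j) (z j)" for j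
    using Pj[of j] unfolding P_def by blast+
  have "\<exists>c\<ge>0. \<forall>y\<in>gcarrier E. norm (u j y) * b (i j) q \<le> c * gnorm E (\<phi> q) y" for j q
    using Pj[of j] unfolding P_def by blast
  then obtain cu where cu: "\<And>j q. 0 \<le> cu j q"
    "\<And>j q y. y \<in> gcarrier E \<Longrightarrow> norm (u j y) * b (i j) q \<le> cu j q * gnorm E (\<phi> q) y" by metis
  have "\<exists>c\<ge>0. gnorm F q (z j) \<le> c * b (i j) (\<phi> q)" for j q
    using Pj[of j] unfolding P_def by blast
  then have ex: "\<exists>c. 0 \<le> c \<and> gnorm F q (z j) \<le> c * b (i j) (\<phi> q)" for j q by blast
  define cz where "cz j q = (SOME c. 0 \<le> c \<and> gnorm F q (z j) \<le> c * b (i j) (\<phi> q))" for j q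
  have cz: "0 \<le> cz j q" "gnorm F q (z j) \<le> cz j q * b (i j) (\<phi> q)" for j q
    using someI_ex[OF ex, of q j] unfolding cz_def by blast+
  \<comment> \<open>At each fixed grade \<open>q\<close> all but finitely many of the unweighted
    factors have norm at most \<open>1\<close>, so dyadic weights suffice for all grades at
    once.\<close>
  define au where "au j q = (1 / 2) ^ j * (if q \<le> j then 1 else cu j q)" for j q
  define az where "az j q = (1 / 2) ^ j * (if q \<le> j then 1 else cz j q)" for j q
  have au: "0 \<le> au j q" "summable (\<lambda>j. au j q)" and az: "0 \<le> az j q" "summable (\<lambda>j. az j q)" for j q
    unfolding au_def az_def using cu(1) cz(1) by (auto intro: summable_dyadic_weights)
  have u_le: "norm (u j y) * b (i j) q \<le> (if q \<le> j then 1 else cu j q) * gnorm E (\<phi> q) y"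
    if "y \<in> gcarrier E" for j q y
    using Pj[of j] cu(2)[OF that] that unfolding P_def by simp
  have z_le: "gnorm F q (z j) \<le> (if q \<le> j then 1 else cz j q) * b (i j) (\<phi> q)" for j q
    using Pj[of j] cz(2) unfolding P_def by simp
  define h :: "nat \<Rightarrow> 'k" where "h j = of_real ((1 / 2) ^ j)" for j
  have h: "norm (h j) = (1 / 2) ^ j" for j unfolding h_def norm_of_real by simp
  define Q where "Q j y = gscale ?K (h j * u j y) (unit_seq (i j))" for j y
  define R where "R j y = gscale F (h j * y (i j)) (z j)" for j and y :: "nat \<Rightarrow> 'k"
  note mK = graded_module[OF gr] and mF = graded_module[OF gF]
  have Qm: "Q j y \<in> gcarrier ?K" for j y
    unfolding Q_def by (rule graded_scale_mem[OF gr unit_seq_mem])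
  have Ql: "linear_map_on (gcarrier E) (gscale E) (gscale ?K) (Q j)" for j
    using u[of j] unfolding linear_map_on_def Q_def
    by (simp add: distrib_left module.scale_left_distrib[OF mK] module.scale_scale[OF mK] mult_ac)
  have Qb: "gnorm ?K q (Q j y) \<le> au j q * gnorm E (\<phi> q) y" if "y \<in> gcarrier E" for j q y
  proof -
    have "gnorm ?K q (Q j y) = (1 / 2) ^ j * (norm (u j y) * b (i j) q)"
      unfolding Q_def gnorm_scale[OF gr unit_seq_mem] gnorm_unit_seq by (simp add: norm_mult h)
    also have "\<dots> \<le> (1 / 2) ^ j * ((if q \<le> j then 1 else cu j q) * gnorm E (\<phi> q) y)"
      by (rule mult_left_mono[OF u_le[OF that]]) simp
    finally show ?thesis unfolding au_def by (simp only: mult.assoc)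
  qed
  have Rm: "R j y \<in> gcarrier F" for j y
    unfolding R_def by (rule graded_scale_mem[OF gF z])
  have Rl: "linear_map_on (gcarrier ?K) (gscale ?K) (gscale F) (R j)" for j
    unfolding linear_map_on_def R_def gscale_koethe
    by (simp add: distrib_left module.scale_left_distrib[OF mF] module.scale_scale[OF mF] mult_ac)
  have Rb: "gnorm F q (R j y) \<le> az j q * gnorm ?K (\<phi> q) y" if "y \<in> gcarrier ?K" for j q y
  proof -
    have "gnorm F q (R j y) = (1 / 2) ^ j * norm (y (i j)) * gnorm F q (z j)"
      unfolding R_def gnorm_scale[OF gF z] by (simp add: norm_mult h)
    also have "\<dots> \<le> (1 / 2) ^ j * norm (y (i j)) * ((if q \<le> j then 1 else cz j q) * b (i j) (\<phi> q))"
      by (rule mult_left_mono[OF z_le]) simp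
    also have "\<dots> = az j q * (norm (y (i j)) * b (i j) (\<phi> q))" unfolding az_def by (simp add: mult_ac)
    also have "\<dots> \<le> az j q * gnorm ?K (\<phi> q) y"
      by (rule mult_left_mono[OF koethe_coord_le[OF b that] az(1)])
    finally show ?thesis .
  qed
  obtain VQ where VQ: "\<And>w. VQ w \<in> operators E ?K"
    and VQb: "\<And>w q y. y \<in> gcarrier E \<Longrightarrow> gnorm ?K q (VQ w y) \<le> (\<Sum>j. au j q) * gnorm E (\<phi> q) y"
    and VQd: "\<And>w w' n q y. \<lbrakk>\<forall>j<n. w j = w' j; y \<in> gcarrier E\<rbrakk> \<Longrightarrow>
      gnorm ?K q (VQ w y - VQ w' y) \<le> 2 * (\<Sum>j. au (j + n) q) * gnorm E (\<phi> q) y"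
    and VQ1: "\<And>w j y. y \<in> gcarrier E \<Longrightarrow> VQ (w(j := True)) y - VQ (w(j := False)) y = Q j y"
    by (rule masked_operator_series[OF E FK Qm Ql Qb au]) (assumption | rule that | blast)+
  obtain VR where VR: "\<And>w. VR w \<in> operators ?K F"
    and VRb: "\<And>w q y. y \<in> gcarrier ?K \<Longrightarrow> gnorm F q (VR w y) \<le> (\<Sum>j. az j q) * gnorm ?K (\<phi> q) y"
    and VRd: "\<And>w w' n q y. \<lbrakk>\<forall>j<n. w j = w' j; y \<in> gcarrier ?K\<rbrakk> \<Longrightarrow>
      gnorm F q (VR w y - VR w' y) \<le> 2 * (\<Sum>j. az (j + n) q) * gnorm ?K (\<phi> q) y"
    and VR1: "\<And>w j y. y \<in> gcarrier ?K \<Longrightarrow> VR (w(j := True)) y - VR (w(j := False)) y = R j y"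
    by (rule masked_operator_series[OF gr F Rm Rl Rb az]) (assumption | rule that | blast)+
  have VQm: "VQ w y \<in> gcarrier ?K" if "y \<in> gcarrier E" for w y
    using VQ[of w] that unfolding operators_def by blast
  have VRm: "VR w y \<in> gcarrier F" if "y \<in> gcarrier ?K" for w y
    using VR[of w] that unfolding operators_def by blast
  have VRl: "VR w (y - y') = VR w y - VR w y'" if "y \<in> gcarrier ?K" "y' \<in> gcarrier ?K" for w y y'
    using VR[of w] linear_map_on_diff[OF _ gr that] unfolding operators_def by blast
  \<comment> \<open>One sequence of bit pairs carries both masks: Baire's theorem applies to them
    jointly, yet the bits of the two factors can be switched independently.\<close>
  define T where "T w y = VR (snd \<circ> w) (VQ (fst \<circ> w) y)" for w :: "nat \<Rightarrow> bool \<times> bool" and y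
  have Tm: "T w y \<in> gcarrier F" if "y \<in> gcarrier E" for w y unfolding T_def by (intro VRm VQm that)
  have Top: "T w \<in> factoring_operators E ?K F" for w
    unfolding T_def[abs_def] by (rule factoring_operators_comp[OF VQ VR])
  \<comment> \<open>The index \<open>m\<close> encodes the number of a bad grade and an integer
    bound. Tameness is tested at bad grades only, and since \<open>k0 \<le> \<beta> k0\<close>, each
    operator passes the test at \<open>\<beta> k0\<close> for its own threshold
    \<open>k0\<close>.\<close>
  define A where "A m = {w. \<forall>y\<in>gcarrier E. gnorm F (\<beta> (fst (prod_decode m))) (T w y)
      \<le> real (snd (prod_decode m)) * gnorm E (S (\<beta> (fst (prod_decode m)))) y}" for m
  obtain m v n where mvn: "\<And>w. (\<And>j. j < n \<Longrightarrow> w j = v j) \<Longrightarrow> w \<in> A m"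
  proof (rule sequences_Baire[of A])
    fix w
    obtain k0 where "\<forall>k\<ge>k0. char_of_continuity E F (T w) k \<le> enat (S k)" using tame[OF Top] by blast
    then have "op_norm E F (\<beta> k0) (S (\<beta> k0)) (T w) < \<infinity>"
      using \<beta>(1) char_of_continuity_le_iff[OF E] by blast
    then obtain c where c: "0 \<le> c" "op_norm E F (\<beta> k0) (S (\<beta> k0)) (T w) = ennreal c"
      by (cases "op_norm E F (\<beta> k0) (S (\<beta> k0)) (T w)" rule: ennreal_cases) auto
    have "T w \<in> operators E F" using Top unfolding factoring_operators_def by blast
    from op_norm_le_iff[OF E gF this c(1)] c(2)
    have c': "gnorm F (\<beta> k0) (T w y) \<le> c * gnorm E (S (\<beta> k0)) y" if "y \<in> gcarrier E" for y
      using that by (metis order_refl)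
    obtain M :: nat where M: "c \<le> real M" using real_arch_simple by blast
    have "gnorm F (\<beta> k0) (T w y) \<le> real M * gnorm E (S (\<beta> k0)) y" if "y \<in> gcarrier E" for y
      using c'[OF that] mult_right_mono[OF M gnorm_nonneg[OF E that], of "S (\<beta> k0)"] by linarith
    then show "\<exists>m. w \<in> A m" unfolding A_def by (intro exI[of _ "prod_encode (k0, M)"]) simp
  next
    fix m w assume ap: "\<And>n. \<exists>v\<in>A m. \<forall>j<n. v j = w j"
    define k where "k = \<beta> (fst (prod_decode m))"
    define M where "M = real (snd (prod_decode m))"
    have "gnorm F k (T w y) \<le> M * gnorm E (S k) y" if y: "y \<in> gcarrier E" for y
    proof -
      let ?N = "gnorm E (\<phi> (\<phi> k)) y"
      \<comment> \<open>The cost of replacing \<open>w\<close> by a \<open>v\<close> that agrees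
        with it below \<open>n\<close>: the first summand changes the mask of the inner factor, the
        second that of the outer one. Both contain a tail, so they vanish in the limit and the grade
        \<open>\<phi> (\<phi> k)\<close> does not spoil the bound at grade
        \<open>S k\<close>.\<close>
      let ?e = "\<lambda>n. (\<Sum>j. az j k) * (2 * (\<Sum>j. au (j + n) (\<phi> k)) * ?N)
          + 2 * (\<Sum>j. az (j + n) k) * ((\<Sum>j. au j (\<phi> k)) * ?N)"
      have "gnorm F k (T w y) \<le> M * gnorm E (S k) y + ?e n" for n
      proof -
        obtain v where v: "v \<in> A m" "\<forall>j<n. v j = w j" using ap by blast
        let ?q = "VQ (fst \<circ> w) y" and ?q' = "VQ (fst \<circ> v) y"
        have q: "?q \<in> gcarrier ?K" "?q' \<in> gcarrier ?K" by (intro VQm y)+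
        have eq: "T w y - T v y = VR (snd \<circ> w) (?q - ?q') + (VR (snd \<circ> w) ?q' - VR (snd \<circ> v) ?q')"
          unfolding T_def by (simp add: VRl q)
        have le: "gnorm F k (T w y - T v y)
            \<le> gnorm F k (VR (snd \<circ> w) (?q - ?q')) + gnorm F k (VR (snd \<circ> w) ?q' - VR (snd \<circ> v) ?q')"
          unfolding eq by (intro gnorm_triangle[OF gF] graded_diff_mem[OF gF] VRm graded_diff_mem[OF gr] q)
        have agree: "\<forall>j<n. (fst \<circ> w) j = (fst \<circ> v) j" "\<forall>j<n. (snd \<circ> w) j = (snd \<circ> v) j" using v(2) by simp_all
        have "gnorm F k (VR (snd \<circ> w) (?q - ?q')) \<le> (\<Sum>j. az j k) * gnorm ?K (\<phi> k) (?q - ?q')"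
          by (rule VRb[OF graded_diff_mem[OF gr q]])
        moreover have "(\<Sum>j. az j k) * gnorm ?K (\<phi> k) (?q - ?q') \<le> (\<Sum>j. az j k) * (2 * (\<Sum>j. au (j + n) (\<phi> k)) * ?N)"
          by (intro mult_left_mono VQd[OF agree(1) y] suminf_nonneg az)
        moreover have "gnorm F k (VR (snd \<circ> w) ?q' - VR (snd \<circ> v) ?q') \<le> 2 * (\<Sum>j. az (j + n) k) * gnorm ?K (\<phi> k) ?q'"
          by (rule VRd[OF agree(2) q(2)])
        moreover have "2 * (\<Sum>j. az (j + n) k) * gnorm ?K (\<phi> k) ?q' \<le> 2 * (\<Sum>j. az (j + n) k) * ((\<Sum>j. au j (\<phi> k)) * ?N)"
          by (intro mult_left_mono VQb[OF y] mult_nonneg_nonneg suminf_nonneg summable_ignore_initial_segment az) simp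
        ultimately have "gnorm F k (T w y - T v y) \<le> ?e n" using le by linarith
        moreover have "gnorm F k (T v y) \<le> M * gnorm E (S k) y"
          using v(1) y unfolding A_def k_def M_def by blast
        ultimately show ?thesis
          using gnorm_le_add_diff[OF gF Tm[OF y, of w] Tm[OF y, of v], of k] by linarith
      qed
      moreover have "(\<lambda>n. M * gnorm E (S k) y + ?e n) \<longlonglongrightarrow> M * gnorm E (S k) y
          + ((\<Sum>j. az j k) * (2 * 0 * ?N) + 2 * 0 * ((\<Sum>j. au j (\<phi> k)) * ?N))"
        by (intro tendsto_intros tendsto_tail_0 au az)
      ultimately have "gnorm F k (T w y) \<le> M * gnorm E (S k) y
          + ((\<Sum>j. az j k) * (2 * 0 * ?N) + 2 * 0 * ((\<Sum>j. au j (\<phi> k)) * ?N))"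
        by (intro LIMSEQ_le_const) auto
      then show ?thesis by simp
    qed
    then show "w \<in> A m" unfolding A_def k_def M_def by blast
  qed (blast intro: that)
  define k where "k = \<beta> (fst (prod_decode m))"
  define M where "M = snd (prod_decode m)"
  have bound: "gnorm F k (T w y) \<le> real M * gnorm E (S k) y"
    if "\<And>j. j < n \<Longrightarrow> w j = v j" "y \<in> gcarrier E" for w y
    using mvn[OF that(1)] that(2) unfolding A_def k_def M_def by blast
  \<comment> \<open>The first component gives \<open>\<kappa> j = k\<close>. The second one, which
    is at most its code \<open>j\<close>, puts \<open>j\<close> beyond the fixed bits of the
    cylinder and makes it at least \<open>4 * M\<close>, one \<open>M\<close> for each of the four
    operators compared below.\<close>
  define j where "j = prod_encode (fst (prod_decode m), max n (4 * M))"
  have j: "n \<le> j" "4 * M \<le> j" "\<kappa> j = k"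
    using le_prod_encode_2[of "max n (4 * M)" "fst (prod_decode m)"] unfolding j_def \<kappa>_def k_def by auto
  let ?w = "\<lambda>a c. v(j := (a, c))"
  let ?q = "\<lambda>a. VQ ((fst \<circ> v)(j := a)) (x j)" and ?r = "\<lambda>c. VR ((snd \<circ> v)(j := c))"
  have q: "?q a \<in> gcarrier ?K" for a by (intro VQm x)
  have T_eq: "T (?w a c) (x j) = ?r c (?q a)" for a c
    unfolding T_def by (simp add: fun_upd_comp)
  have T_le: "gnorm F k (T (?w a c) (x j)) \<le> real M" for a c
  proof -
    have "gnorm F k (T (?w a c) (x j)) \<le> real M * gnorm E (S k) (x j)"
      using j(1) x(1) by (intro bound) auto
    also have "\<dots> \<le> real M * 1" using x(2)[of j] unfolding j(3) by (intro mult_left_mono) auto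
    finally show ?thesis by simp
  qed
  have Tw: "T (?w a c) (x j) \<in> gcarrier F" for a c by (rule Tm[OF x(1)])
  \<comment> \<open>Bilinearity isolates the \<open>j\<close>-th term as an alternating sum over four members of the cylinder.\<close>
  have "(T (?w True True) (x j) - T (?w False True) (x j)) - (T (?w True False) (x j) - T (?w False False) (x j))
      = ?r True (?q True - ?q False) - ?r False (?q True - ?q False)"
    unfolding T_eq by (simp only: VRl[OF q q])
  also have "\<dots> = R j (Q j (x j))"
    by (simp only: VQ1[OF x(1)] VR1[OF Qm])
  also have "\<dots> = gscale F (h j * (h j * u j (x j))) (z j)"
    unfolding R_def Q_def gscale_koethe by (simp add: unit_seq_def)
  finally have eq: "(T (?w True True) (x j) - T (?w False True) (x j)) - (T (?w True False) (x j) - T (?w False False) (x j))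
      = gscale F (h j * (h j * u j (x j))) (z j)" .
  have "(1 / 4) ^ j * (norm (u j (x j)) * gnorm F k (z j)) = gnorm F k (gscale F (h j * (h j * u j (x j))) (z j))"
    unfolding gnorm_scale[OF gF z] by (simp add: norm_mult h mult.assoc[symmetric] flip: power_mult_distrib)
  moreover have "gnorm F k (gscale F (h j * (h j * u j (x j))) (z j)) \<le> real (4 * M)"
    unfolding eq[symmetric]
    using gnorm_triangle_diff[OF gF graded_diff_mem[OF gF Tw Tw] graded_diff_mem[OF gF Tw Tw],
        of k True True False True True False False False]
      gnorm_triangle_diff[OF gF Tw Tw, of k True True False True]
      gnorm_triangle_diff[OF gF Tw Tw, of k True False False False]
      T_le[of True True] T_le[of False True] T_le[of True False] T_le[of False False] by simp
  \<comment> \<open>The contradiction is the chain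
    \<open>4 ^ j < real (4 * M) \<le> real j < 2 ^ j \<le> 4 ^ j\<close>.\<close>
  moreover have "(1 / 4) ^ j * 16 ^ j < (1 / 4) ^ j * (norm (u j (x j)) * gnorm F k (z j))"
    using x(3)[of j] unfolding j(3) by (intro mult_strict_left_mono) auto
  moreover have "(1 / 4 :: real) ^ j * 16 ^ j = 4 ^ j" by (simp flip: power_mult_distrib)
  moreover have "real (4 * M) \<le> real j" using j(2) by linarith
  moreover have "real j < 2 ^ j" "(2 :: real) ^ j \<le> 4 ^ j"
    by (rule of_nat_less_two_power, rule power_mono) simp_all
  ultimately show False by linarith
qed

section \<open>Equivalence of tame factorization and the rank one estimate\<close>

theorem proposition4p2:
  fixes E :: "('k::{real_normed_field, banach}, 'e::ab_group_add) graded_space"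
    and F :: "('k, 'f::ab_group_add) graded_space"
    and b :: "nat \<Rightarrow> nat \<Rightarrow> real"
  assumes "frechet_space E" and "frechet_space F"
    and "koethe_matrix b"
    and "nuclear (koethe_space b :: ('k, nat \<Rightarrow> 'k) graded_space)"
  shows "tame_factorization E (koethe_space b :: ('k, nat \<Rightarrow> 'k) graded_space) F \<longleftrightarrow>
    (\<exists>S :: nat \<Rightarrow> nat. mono S \<and>
      (\<forall>\<phi> :: nat \<Rightarrow> nat. mono \<phi> \<longrightarrow>
        (\<exists>k0. \<forall>k\<ge>k0. \<exists>(qk :: nat) (C :: real). C > 0 \<and>
          (\<forall>u\<in>dual E. \<forall>z\<in>gcarrier F. \<forall>i.
            dual_norm E (S k) u * ennreal (gnorm F k z)
              \<le> ennreal C * max_prod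
                  (MAX q\<in>{..qk}. dual_norm E (\<phi> q) u * ennreal (b i q))
                  (MAX q\<in>{..qk}. ennreal (gnorm F q z) / ennreal (b i (\<phi> q)))))))"
  unfolding rank_one_estimate_def[symmetric]
proof
  have E: "graded E" and F: "graded F" using assms(1,2) unfolding frechet_space_def by auto
  \<comment> \<open>The function \<open>S\<close> is carried over unchanged in both
    directions.\<close>
  let ?est = "\<lambda>S \<phi>. \<exists>k0. \<forall>k\<ge>k0. \<exists>q C. C > 0 \<and> rank_one_estimate E F b \<phi> (S k) k q C"
  show "\<exists>S. mono S \<and> (\<forall>\<phi>. mono \<phi> \<longrightarrow> ?est S \<phi>)"
    if tame: "tame_factorization E (koethe_space b :: ('k, nat \<Rightarrow> 'k) graded_space) F"
  proof -
    obtain S where "mono S" and S: "\<And>T. T \<in> factoring_operators E (koethe_space b) F \<Longrightarrow>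
        \<exists>k0. \<forall>k\<ge>k0. char_of_continuity E F T k \<le> enat (S k)"
      using tame unfolding tame_factorization_def by blast
    have "?est S \<phi>" if "mono \<phi>" for \<phi>
      by (rule estimate_of_tame_factorization[OF E assms(2,3) that S])
    then show ?thesis using \<open>mono S\<close> by blast
  qed
  show "tame_factorization E (koethe_space b :: ('k, nat \<Rightarrow> 'k) graded_space) F"
    if est: "\<exists>S. mono S \<and> (\<forall>\<phi>. mono \<phi> \<longrightarrow> ?est S \<phi>)"
  proof -
    obtain S where "mono S" and S: "\<And>\<phi>. mono \<phi> \<Longrightarrow> ?est S \<phi>" using est by blast
    then show ?thesis by (intro tame_factorization_of_estimate[OF E F assms(3,4)])
  qed
qed

end
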